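(* Let $H$ be a Hilbert space. For every compact convex set $K\subset\mathbb{R}^2$, the weak operator topology and the strong operator topology coincide on the set $$\{T\in\mathcal{B}(H):\ T\ \text{normal and}\ \sigma(T)\subset\mathrm{ex}(K)\}.$$
   Context: $\mathbb{R}^2$ is identified with $\mathbb{C}$, $H$ is a complex Hilbert space, $\sigma(T)$ is the spectrum of $T$, and $\mathrm{ex}(K)$ is the set of extreme points of $K$. *)

theory Defs
  imports "HOL-Analysis.Analysis"
begin

(* The inner product is linear in its first argument. Axiom cinner_self says that it is positive
   definite and induces the norm; scaleC_of_real says that the real vector space structure is
   the restriction of the complex one. *)
class complex_inner = real_normed_vector +
  fixes scaleC :: "complex \<Rightarrow> 'a \<Rightarrow> 'a"  (infixr \<open>*\<^sub>C\<close> 75)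
    and cinner :: "'a \<Rightarrow> 'a \<Rightarrow> complex"
  assumes scaleC_add_right: "a *\<^sub>C (x + y) = a *\<^sub>C x + a *\<^sub>C y"
    and scaleC_add_left: "(a + b) *\<^sub>C x = a *\<^sub>C x + b *\<^sub>C x"
    and scaleC_scaleC: "a *\<^sub>C b *\<^sub>C x = (a * b) *\<^sub>C x"
    and scaleC_of_real: "complex_of_real r *\<^sub>C x = r *\<^sub>R x"
    and cinner_commute: "cinner x y = cnj (cinner y x)"
    and cinner_add_left: "cinner (x + y) z = cinner x z + cinner y z"
    and cinner_scaleC_left: "cinner (a *\<^sub>C x) y = a * cinner x y"
    and cinner_self: "cinner x x = complex_of_real ((norm x)\<^sup>2)"

class complex_hilbert_space = complex_inner + complete_space

instantiation complex :: complex_hilbert_space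
begin

definition scaleC_complex :: "complex \<Rightarrow> complex \<Rightarrow> complex" where
  "scaleC_complex a x = a * x"

definition cinner_complex :: "complex \<Rightarrow> complex \<Rightarrow> complex" where
  "cinner_complex x y = x * cnj y"

instance
  by standard
    (auto simp: scaleC_complex_def cinner_complex_def algebra_simps scaleR_conv_of_real
      complex_norm_square[symmetric])

end

lemma cinner_add_right: "cinner x (y + z) = cinner x y + cinner (x :: 'a :: complex_inner) z"
  by (metis cinner_add_left cinner_commute complex_cnj_add)

lemma cinner_scaleC_right: "cinner x (a *\<^sub>C y) = cnj a * cinner (x :: 'a :: complex_inner) y"
  by (metis cinner_scaleC_left cinner_commute complex_cnj_mult)

lemma cinner_scaleR_left: "cinner (r *\<^sub>R x) y = of_real r * cinner (x :: 'a :: complex_inner) y"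
  by (metis cinner_scaleC_left scaleC_of_real)

lemma cinner_scaleR_right: "cinner x (r *\<^sub>R y) = of_real r * cinner (x :: 'a :: complex_inner) y"
  by (metis cinner_scaleC_right scaleC_of_real complex_cnj_complex_of_real)

lemma cinner_minus_left: "cinner (- x) y = - cinner (x :: 'a :: complex_inner) y"
  using cinner_scaleR_left[of "-1" x y] by simp

lemma cinner_minus_right: "cinner x (- y) = - cinner (x :: 'a :: complex_inner) y"
  using cinner_scaleR_right[of x "-1" y] by simp

lemma cinner_diff_left: "cinner (x - y) z = cinner x z - cinner (y :: 'a :: complex_inner) z"
  using cinner_add_left[of x "- y" z] by (simp add: cinner_minus_left)

lemma cinner_diff_right: "cinner x (y - z) = cinner x y - cinner (x :: 'a :: complex_inner) z"
  using cinner_add_right[of x y "- z"] by (simp add: cinner_minus_right)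

lemma Re_cinner_commute: "Re (cinner x y) = Re (cinner (y :: 'a :: complex_inner) x)"
  by (metis cinner_commute cnj.sel(1))

lemma norm_add_squared:
  "(norm (x + y))\<^sup>2 = (norm x)\<^sup>2 + 2 * Re (cinner x y) + (norm (y :: 'a :: complex_inner))\<^sup>2"
proof -
  have "Re (cinner (x + y) (x + y)) = Re (cinner x x) + 2 * Re (cinner x y) + Re (cinner y y)"
    using Re_cinner_commute[of x y] by (simp add: cinner_add_left cinner_add_right)
  then show ?thesis by (simp only: cinner_self Re_complex_of_real)
qed

lemma Re_cinner_le: "Re (cinner x y) \<le> norm x * norm (y :: 'a :: complex_inner)"
proof -
  have "(norm (x + y))\<^sup>2 \<le> (norm x + norm y)\<^sup>2"
    by (intro power_mono norm_triangle_ineq norm_ge_zero)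
  then show ?thesis by (simp add: norm_add_squared power2_sum)
qed

lemma norm_scaleC: "norm (a *\<^sub>C x) = cmod a * norm (x :: 'a :: complex_inner)"
proof -
  have "complex_of_real ((norm (a *\<^sub>C x))\<^sup>2) = a * cnj a * complex_of_real ((norm x)\<^sup>2)"
    by (simp only: cinner_self[symmetric] cinner_scaleC_left cinner_scaleC_right mult_ac)
  also have "\<dots> = complex_of_real ((cmod a * norm x)\<^sup>2)"
    by (simp only: power_mult_distrib of_real_mult complex_norm_square)
  finally have "(norm (a *\<^sub>C x))\<^sup>2 = (cmod a * norm x)\<^sup>2"
    by (simp only: of_real_eq_iff)
  then show ?thesis by (simp add: power2_eq_iff_nonneg)
qed

lift_definition scalar_op :: "complex \<Rightarrow> 'a :: complex_inner \<Rightarrow>\<^sub>L 'a" is "\<lambda>c x. c *\<^sub>C x"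
proof (rule bounded_linear_intro)
  fix c :: complex and r :: real and x y :: 'a
  show "c *\<^sub>C (x + y) = c *\<^sub>C x + c *\<^sub>C y" by (rule scaleC_add_right)
  show "c *\<^sub>C r *\<^sub>R x = r *\<^sub>R c *\<^sub>C x"
    by (metis scaleC_of_real scaleC_scaleC mult.commute)
  show "norm (c *\<^sub>C x) \<le> norm x * cmod c" by (simp add: norm_scaleC)
qed

(* B(H): elements of the library type of bounded operators are only real-linear. *)
definition bounded_clinear_ops :: "('a :: complex_inner \<Rightarrow>\<^sub>L 'a) set" where
  "bounded_clinear_ops = {T :: 'a \<Rightarrow>\<^sub>L 'a. \<forall>c x. T (c *\<^sub>C x) = c *\<^sub>C T x}"

definition spectrum :: "('a :: complex_inner \<Rightarrow>\<^sub>L 'a) \<Rightarrow> complex set" where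
  "spectrum T = {z. \<not> (\<exists>S \<in> bounded_clinear_ops.
     S o\<^sub>L (T - scalar_op z) = id_blinfun \<and> (T - scalar_op z) o\<^sub>L S = id_blinfun)}"

definition cadjoint :: "('a :: complex_hilbert_space \<Rightarrow>\<^sub>L 'a) \<Rightarrow> 'a \<Rightarrow>\<^sub>L 'a" where
  "cadjoint T = (THE S. S \<in> bounded_clinear_ops \<and> (\<forall>x y. cinner (T x) y = cinner x (S y)))"

definition normal_op :: "('a :: complex_hilbert_space \<Rightarrow>\<^sub>L 'a) \<Rightarrow> bool" where
  "normal_op T \<longleftrightarrow> cadjoint T o\<^sub>L T = T o\<^sub>L cadjoint T"

(* The initial topology for the maps T \<mapsto> \<langle>T x, y\<rangle>: on a function type, euclidean is the topology
   of pointwise convergence. Compare strong_operator_topology in the library. *)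
definition weak_operator_topology :: "('a :: complex_inner \<Rightarrow>\<^sub>L 'a) topology" where
  "weak_operator_topology = pullback_topology UNIV (\<lambda>T (x, y). cinner (blinfun_apply T x) y) euclidean"

(* The adjoint of an operator in B(H) exists and is unique, so the description in the definition
   of cadjoint denotes it. *)

lemma cinner_right_eqI:
  assumes "\<And>x. cinner x y = cinner x (z :: 'a :: complex_inner)"
  shows "y = z"
proof -
  have "cinner (y - z) (y - z) = 0" using assms[of "y - z"] by (simp add: cinner_diff_right)
  then show ?thesis by (simp add: cinner_self)
qed

lemma riesz_representation:
  fixes f :: "'a :: complex_hilbert_space \<Rightarrow> complex"
  assumes add: "\<And>x y. f (x + y) = f x + f y"
    and scale: "\<And>c x. f (c *\<^sub>C x) = c * f x"
    and bound: "\<And>x. Re (f x) \<le> B * norm x"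
  shows "\<exists>y. \<forall>x. f x = cinner x y"
proof -
  have scaleR: "f (r *\<^sub>R x) = of_real r * f x" for r x
    by (metis scale scaleC_of_real)
  have "\<bar>Re (f x)\<bar> \<le> norm x * B" for x
    using bound[of x] bound[of "- x"] scaleR[of "-1" x] by (simp add: mult.commute)
  then have bl: "bounded_linear (\<lambda>x. Re (f x))"
    by (intro bounded_linear_intro[where K = B]) (simp_all add: add scaleR)
  define J where "J x = (norm x)\<^sup>2 - 2 * Re (f x)" for x
  have J_ge: "- B\<^sup>2 \<le> J x" for x
  proof -
    have "0 \<le> (norm x - B)\<^sup>2" by simp
    then show ?thesis using bound[of x] by (simp add: J_def power2_diff mult.commute)
  qed
  then have bdd: "bdd_below (range J)" by (auto intro!: bdd_belowI)
  define m where "m = Inf (range J)"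
  have m_le: "m \<le> J x" for x unfolding m_def using bdd by (intro cInf_lower) auto
  have "\<exists>x. J x < m + 1 / real (Suc n)" for n
  proof -
    have "Inf (range J) < m + 1 / real (Suc n)" by (simp add: m_def)
    then show ?thesis using cInf_lessD[of "range J"] by blast
  qed
  then obtain X where X: "\<And>n. J (X n) < m + 1 / real (Suc n)" by metis
  have parallelogram: "(norm (x - y))\<^sup>2 = 2 * J x + 2 * J y - 4 * J ((1/2) *\<^sub>R (x + y))" for x y
  proof -
    have "(norm ((1/2) *\<^sub>R (x + y)))\<^sup>2 = (norm (x + y))\<^sup>2 / 4"
      by (simp add: power_divide)
    moreover have "(norm (x - y))\<^sup>2 = (norm x)\<^sup>2 - 2 * Re (cinner x y) + (norm y)\<^sup>2"
      using norm_add_squared[of x "- y"] by (simp add: cinner_minus_right)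
    moreover have "Re (f ((1/2) *\<^sub>R (x + y))) = (Re (f x) + Re (f y)) / 2"
      by (simp add: scaleR add)
    ultimately show ?thesis using norm_add_squared[of x y] by (simp add: J_def)
  qed
  have dist_le: "(norm (X i - X j))\<^sup>2 \<le> 4 / real (Suc N)" if "i \<ge> N" "j \<ge> N" for i j N
  proof -
    have "1 / real (Suc i) \<le> 1 / real (Suc N)" "1 / real (Suc j) \<le> 1 / real (Suc N)"
      using that by (auto intro!: divide_left_mono)
    then show ?thesis
      using X[of i] X[of j] m_le[of "(1/2) *\<^sub>R (X i + X j)"] parallelogram[of "X i" "X j"]
      by simp
  qed
  have "Cauchy X"
  proof (rule CauchyI)
    fix e :: real assume e: "e > 0"
    obtain N where N: "4 / e\<^sup>2 < real N" using reals_Archimedean2 by blast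
    have "4 / real (Suc N) < e\<^sup>2"
    proof -
      have "4 / e\<^sup>2 < real (Suc N)" using N by simp
      then show ?thesis using e by (simp add: field_simps)
    qed
    then have "norm (X i - X j) < e" if "i \<ge> N" "j \<ge> N" for i j
      using dist_le[OF that] e by (intro power2_less_imp_less[of _ e]) auto
    then show "\<exists>M. \<forall>i\<ge>M. \<forall>j\<ge>M. norm (X i - X j) < e" by blast
  qed
  then obtain y where y: "X \<longlonglongrightarrow> y" using Cauchy_convergent convergentD by blast
  have "(\<lambda>n. J (X n)) \<longlonglongrightarrow> J y"
    unfolding J_def by (intro tendsto_intros y bounded_linear.tendsto[OF bl])
  moreover have "(\<lambda>n. m + 1 / real (Suc n)) \<longlonglongrightarrow> m + 0"
    by (intro tendsto_intros LIMSEQ_Suc lim_1_over_n)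
  ultimately have "J y \<le> m + 0"
    by (rule LIMSEQ_le) (use X in \<open>auto intro!: exI[of _ 0] less_imp_le\<close>)
  then have min: "J y \<le> J x" for x using m_le[of x] by simp
  have Re_eq: "Re (f z) = Re (cinner z y)" for z
  proof (rule ccontr)
    define d where "d = Re (f z) - Re (cinner z y)"
    assume "Re (f z) \<noteq> Re (cinner z y)"
    then have d: "d \<noteq> 0" by (simp add: d_def)
    have quad: "2 * t * d \<le> t\<^sup>2 * (norm z)\<^sup>2" for t
      using min[of "y + t *\<^sub>R z"] Re_cinner_commute[of y z]
      by (simp add: J_def norm_add_squared cinner_scaleR_right add scaleR d_def power_mult_distrib
          algebra_simps)
    have "norm z \<noteq> 0"
    proof
      assume "norm z = 0"
      then show False using quad[of d] d by (auto simp: mult_le_0_iff)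
    qed
    then have p: "(norm z)\<^sup>2 > 0" by simp
    have "2 * (d / (norm z)\<^sup>2) * d \<le> (d / (norm z)\<^sup>2) * d"
    proof -
      have "(d / (norm z)\<^sup>2)\<^sup>2 * (norm z)\<^sup>2 = (d / (norm z)\<^sup>2) * d"
      proof -
        have "(d / c)\<^sup>2 * c = (d / c) * d" if "c > 0" for c :: real
          using that by (simp add: power2_eq_square)
        then show ?thesis using p .
      qed
      then show ?thesis using quad[of "d / (norm z)\<^sup>2"] by simp
    qed
    moreover have "(d / (norm z)\<^sup>2) * d > 0"
    proof -
      have "(d / (norm z)\<^sup>2) * d = d\<^sup>2 / (norm z)\<^sup>2" by (simp add: power2_eq_square)
      also have "\<dots> > 0" using d p by (intro divide_pos_pos) simp_all
      finally show ?thesis .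
    qed
    ultimately show False by simp
  qed
  have "f x = cinner x y" for x
  proof (rule complex_eqI)
    show "Re (f x) = Re (cinner x y)" by (rule Re_eq)
    show "Im (f x) = Im (cinner x y)"
      using Re_eq[of "\<i> *\<^sub>C x"] by (simp add: scale cinner_scaleC_left)
  qed
  then show ?thesis by blast
qed

lemma cadjoint_ex1:
  fixes T :: "'a :: complex_hilbert_space \<Rightarrow>\<^sub>L 'a"
  assumes T: "T \<in> bounded_clinear_ops"
  shows "\<exists>!S. S \<in> bounded_clinear_ops \<and> (\<forall>x y. cinner (T x) y = cinner x (S y))"
proof (rule ex_ex1I)
  have "\<exists>s. \<forall>x. cinner (T x) y = cinner x s" for y
  proof (rule riesz_representation)
    show "cinner (T (a + b)) y = cinner (T a) y + cinner (T b) y" for a b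
      by (simp add: blinfun.add_right cinner_add_left)
    show "cinner (T (c *\<^sub>C a)) y = c * cinner (T a) y" for c a
      using T by (simp add: bounded_clinear_ops_def cinner_scaleC_left)
    show "Re (cinner (T a) y) \<le> (norm T * norm y) * norm a" for a
    proof -
      have "Re (cinner (T a) y) \<le> norm (T a) * norm y" by (rule Re_cinner_le)
      also have "\<dots> \<le> (norm T * norm a) * norm y"
        by (intro mult_right_mono norm_blinfun norm_ge_zero)
      finally show ?thesis by (simp add: mult_ac)
    qed
  qed
  then obtain S where S: "\<And>x y. cinner (T x) y = cinner x (S y)" by metis
  have S_add: "S (a + b) = S a + S b" for a b
    by (rule cinner_right_eqI) (simp add: S[symmetric] cinner_add_right)
  have S_scale: "S (c *\<^sub>C a) = c *\<^sub>C S a" for c a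
    by (rule cinner_right_eqI) (simp add: S[symmetric] cinner_scaleC_right)
  have S_scaleR: "S (r *\<^sub>R a) = r *\<^sub>R S a" for r a
    by (metis S_scale scaleC_of_real)
  have S_bound: "norm (S a) \<le> norm a * norm T" for a
  proof (cases "S a = 0")
    case False
    have "(norm (S a))\<^sup>2 = Re (cinner (T (S a)) a)" by (simp add: S cinner_self)
    also have "\<dots> \<le> norm (T (S a)) * norm a" by (rule Re_cinner_le)
    also have "\<dots> \<le> (norm T * norm (S a)) * norm a"
      by (intro mult_right_mono norm_blinfun norm_ge_zero)
    finally show ?thesis using False by (simp add: power2_eq_square mult_ac)
  qed simp
  have "bounded_linear S" using S_add S_scaleR S_bound by (rule bounded_linear_intro)
  then have "blinfun_apply (Blinfun S) = S" by (rule bounded_linear_Blinfun_apply)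
  then show "\<exists>S. S \<in> bounded_clinear_ops \<and> (\<forall>x y. cinner (T x) y = cinner x (S y))"
    using S S_scale by (intro exI[of _ "Blinfun S"]) (simp add: bounded_clinear_ops_def)
next
  fix S R :: "'a \<Rightarrow>\<^sub>L 'a"
  assume S: "S \<in> bounded_clinear_ops \<and> (\<forall>x y. cinner (T x) y = cinner x (S y))"
    and R: "R \<in> bounded_clinear_ops \<and> (\<forall>x y. cinner (T x) y = cinner x (R y))"
  have "cinner x (S y) = cinner x (R y)" for x y
    by (rule trans[OF conjunct2[OF S, rule_format, symmetric] conjunct2[OF R, rule_format]])
  then show "S = R" by (rule blinfun_eqI[OF cinner_right_eqI])
qed

lemma cadjoint_in_bounded_clinear_ops:
  "T \<in> bounded_clinear_ops \<Longrightarrow> cadjoint T \<in> bounded_clinear_ops"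
  unfolding cadjoint_def using theI'[OF cadjoint_ex1] by blast

lemma cinner_cadjoint:
  "T \<in> bounded_clinear_ops \<Longrightarrow> cinner (T x) y = cinner x (cadjoint T y)"
  unfolding cadjoint_def using theI'[OF cadjoint_ex1] by blast

end

theory Submission
  imports Defs
begin

text \<open>
Let \<open>T\<close> converge weakly to \<open>T\<^sub>0\<close> within normal operators with spectrum in \<open>K\<close>, where the spectrum of
\<open>T\<^sub>0\<close> consists of extreme points. If an affine function \<open>h\<close> is nonnegative on \<open>K\<close>, at least 1 on
\<open>C \<subseteq> K\<close> and at most \<open>\<eta>\<close> on a set \<open>U\<close>, then for \<open>y\<close> in the spectral subspace of \<open>T\<^sub>0\<close> over \<open>U\<close> and
\<open>E\<close> the spectral projection of \<open>T\<close> over \<open>C\<close> we get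
\<open>\<parallel>E y\<parallel>\<^sup>2 \<le> \<langle>h(T) y, y\<rangle> \<longlongrightarrow> \<langle>h(T\<^sub>0) y, y\<rangle> \<le> \<eta> \<parallel>y\<parallel>\<^sup>2\<close>. By Cauchy--Schwarz,
spectral mass of \<open>T\<^sub>0\<close> on the union of finitely many such \<open>U\<close> cannot move into \<open>C\<close> once the sum of
the \<open>\<eta>\<close> is small. In the plane, if \<open>B\<close> is the part of the spectrum of \<open>T\<^sub>0\<close> in \<open>Re z \<le> a\<close> and \<open>C\<close>
is the part of \<open>K\<close> in \<open>Re z \<ge> b > a\<close>, then \<open>B\<close> has covers with arbitrarily small sum: for
supporting lines at \<open>n\<close> equally spaced directions the heights telescope to \<open>O(1/n)\<close>, and at most two
points of \<open>B\<close>, the ends of edges of \<open>K\<close> that reach \<open>C\<close>, need a separate argument. Hence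
\<open>limsup \<parallel>Re T x + M x\<parallel> \<le> \<parallel>Re T\<^sub>0 x + M x\<parallel>\<close> for large \<open>M\<close>, which with weak convergence gives strong
convergence of the real parts; the imaginary parts are treated in the same way after a rotation.

Spectral measures are replaced by a calculus with continuous real functions of two commuting symmetric
operators. Its positivity rests on the existence of joint approximate eigenvalues.
\<close>

section \<open>Real inner product and symmetric operators\<close>

instance complex_hilbert_space \<subseteq> banach ..

abbreviation ip :: "'a \<Rightarrow> 'a :: complex_inner \<Rightarrow> real" where
  "ip x y \<equiv> Re (cinner x y)"

lemma abs_ip_le: "\<bar>ip x y\<bar> \<le> norm x * norm y"
  using Re_cinner_le[of x y] Re_cinner_le[of "- x" y] by (simp add: cinner_minus_left)

lemma norm_diff_squared:
  "(norm (x - y))\<^sup>2 = (norm x)\<^sup>2 - 2 * ip x y + (norm y)\<^sup>2"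
  using norm_add_squared[of x "- y"] by (simp add: cinner_minus_right)

lemma bounded_bilinear_ip: "bounded_bilinear (\<lambda>x y. ip x y)"
proof
  show "\<exists>K. \<forall>a b :: 'a. norm (ip a b) \<le> norm a * norm b * K"
    by (rule exI[of _ 1]) (auto simp: abs_ip_le)
qed (simp_all add: cinner_add_left cinner_add_right cinner_scaleR_left cinner_scaleR_right)

lemmas ip_simps = cinner_add_left cinner_add_right cinner_scaleR_left cinner_scaleR_right
  cinner_diff_left cinner_diff_right cinner_minus_left cinner_minus_right

text \<open>Symmetry refers to the real inner product: elements of the operator type are only
  real-linear, and the calculus lives on the underlying real Hilbert space.\<close>

definition sym_op :: "('a :: complex_inner \<Rightarrow>\<^sub>L 'a) \<Rightarrow> bool" where
  "sym_op S \<longleftrightarrow> (\<forall>x y. ip (S x) y = ip x (S y))"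

definition commute :: "('a :: complex_inner \<Rightarrow>\<^sub>L 'a) \<Rightarrow> ('a \<Rightarrow>\<^sub>L 'a) \<Rightarrow> bool" where
  "commute R S \<longleftrightarrow> (\<forall>x. R (S x) = S (R x))"

lemma commute_sym: "commute R S \<Longrightarrow> commute S R"
  by (simp add: commute_def)

section \<open>Joint approximate eigenvalues\<close>

text \<open>\<open>Z\<close> measures how far a vector is from being an approximate eigenvector of operators already
treated. The proof takes for \<open>\<alpha>\<close> the norm of \<open>P\<close> in the limit \<open>Z \<rightarrow> 0\<close> and factors
\<open>P\<^sup>2 - \<alpha>\<^sup>2 = (P + \<alpha>) (P - \<alpha>)\<close>, where coercivity makes the first factor bounded below.\<close>

lemma approx_eigenvalue_coercive:
  fixes P :: "'a :: complex_inner \<Rightarrow>\<^sub>L 'a"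
  assumes sym: "sym_op P"
    and coercive: "\<And>x. (norm x)\<^sup>2 \<le> ip (P x) x"
    and Z0: "\<And>x. 0 \<le> Z x"
    and Z_scale: "\<And>r x. Z (r *\<^sub>R x) = \<bar>r\<bar> * Z x"
    and Z_P: "\<And>x. Z (P x) \<le> c * Z x"
    and ex: "\<And>e. e > 0 \<Longrightarrow> \<exists>x. norm x = 1 \<and> Z x < e \<and> q \<le> ip (P x) x"
  shows "\<exists>\<alpha>\<ge>q. \<forall>e>0. \<exists>x. norm x = 1 \<and> Z x < e \<and> norm (P x - \<alpha> *\<^sub>R x) < e"
proof -
  \<comment> \<open>Upper bounds for the norm of \<open>P x\<close> over unit vectors with small
    \<open>Z x\<close>; the infimum \<open>\<alpha>\<close> is the limit superior of that norm as
    \<open>Z x\<close> tends to 0.\<close>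
  define U where "U = {a. \<exists>d>0. \<forall>x. norm x = 1 \<and> Z x < d \<longrightarrow> norm (P x) \<le> a}"
  define \<alpha> where "\<alpha> = Inf U"
  have nP: "norm x \<le> norm (P x)" for x
  proof (cases "x = 0")
    case False
    have "norm x * norm x \<le> norm (P x) * norm x"
      using coercive[of x] abs_ip_le[of "P x" x] by (simp add: power2_eq_square)
    then show ?thesis using False by simp
  qed simp
  have "norm P \<in> U"
    unfolding U_def
  proof (intro CollectI exI[of _ 1] conjI allI impI)
    fix x assume "norm x = 1 \<and> Z x < 1"
    then show "norm (P x) \<le> norm P" using norm_blinfun[of P x] by simp
  qed simp
  then have ne: "U \<noteq> {}" by blast
  have low: "1 \<le> a \<and> q \<le> a" if aU: "a \<in> U" for a
  proof -
    obtain d where d: "d > 0" "\<forall>x. norm x = 1 \<and> Z x < d \<longrightarrow> norm (P x) \<le> a"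
      using aU unfolding U_def mem_Collect_eq by (elim exE conjE)
    obtain x where x: "norm x = 1" "Z x < d" "q \<le> ip (P x) x" using ex[OF d(1)] by blast
    have "ip (P x) x \<le> norm (P x)" using abs_ip_le[of "P x" x] x by simp
    then show ?thesis using d(2)[rule_format, of x] nP[of x] x by simp
  qed
  have bdd: "bdd_below U" using low by (intro bdd_belowI[of _ 1]) blast
  have a1: "1 \<le> \<alpha>" unfolding \<alpha>_def using low ne by (intro cInf_greatest) auto
  have aq: "q \<le> \<alpha>" unfolding \<alpha>_def using low ne by (intro cInf_greatest) auto
  \<comment> \<open>The bound is what remains of \<open>\<alpha> ^ 4 - (2 * \<alpha>\<^sup>2 -
    (\<alpha> + t)\<^sup>2) * (\<alpha> - t)\<^sup>2\<close> after dropping a negative term; it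
    vanishes as \<open>t\<close> tends to 0.\<close>
  have main: "\<exists>x. norm x = 1 \<and> Z x < t \<and> (norm (P x - \<alpha> *\<^sub>R x))\<^sup>2 \<le> 4 * \<alpha> ^ 3 * t + t ^ 4"
    if t: "0 < t" "t < 1/4" for t
  proof -
    have "\<exists>a\<in>U. a < \<alpha> + t"
      using cInf_lessD[OF ne, of "\<alpha> + t"] t unfolding \<alpha>_def by auto
    then obtain a where a: "a < \<alpha> + t" "a \<in> U" by blast
    then obtain d0 where d0: "d0 > 0"
      "\<forall>x. norm x = 1 \<and> Z x < d0 \<longrightarrow> norm (P x) \<le> a"
      unfolding U_def mem_Collect_eq by (elim exE conjE)
    have a0: "a \<ge> 1" using low a by blast
    have scaled: "norm (P x) \<le> a * norm x" if "x \<noteq> 0" "Z x < d0 * norm x" for x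
    proof -
      have "norm ((1 / norm x) *\<^sub>R x) = 1" using that by simp
      moreover have "Z ((1 / norm x) *\<^sub>R x) < d0"
        using that by (simp add: Z_scale field_simps)
      ultimately have "norm (P ((1 / norm x) *\<^sub>R x)) \<le> a" using d0(2) by blast
      then show ?thesis using that by (simp add: blinfun.scaleR_right field_simps)
    qed
    \<comment> \<open>Small enough that \<open>Z (P x) < d0 * norm (P x)\<close>, so that
      \<open>scaled\<close> applies to \<open>P x\<close> as well.\<close>
    define d where "d = min t (d0 / (\<bar>c\<bar> + 1))"
    have d: "d > 0" using t d0 by (simp add: d_def)
    have "\<alpha> - t \<notin> U"
      using cInf_lower[OF _ bdd, of "\<alpha> - t"] t unfolding \<alpha>_def by auto
    then obtain x where x: "norm x = 1" "Z x < d" "norm (P x) > \<alpha> - t"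
      unfolding U_def using d by (auto simp: not_le)
    have Px: "1 \<le> norm (P x)" using nP[of x] x by simp
    have "c * Z x \<le> \<bar>c\<bar> * Z x" using Z0 by (intro mult_right_mono) auto
    also have "\<dots> \<le> (\<bar>c\<bar> + 1) * Z x" using Z0[of x] by (simp add: algebra_simps)
    also have "\<dots> < (\<bar>c\<bar> + 1) * d" using x by (intro mult_strict_left_mono) auto
    also have "\<dots> \<le> (\<bar>c\<bar> + 1) * (d0 / (\<bar>c\<bar> + 1))"
      by (intro mult_left_mono) (auto simp: d_def)
    also have "\<dots> = d0" by simp
    also have "\<dots> \<le> d0 * norm (P x)" using Px d0 by simp
    finally have "Z (P x) < d0 * norm (P x)" using Z_P[of x] by simp
    then have PP: "norm (P (P x)) \<le> a * norm (P x)" using scaled[of "P x"] Px by force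
    define w where "w = P x - \<alpha> *\<^sub>R x"
    have "(norm (P (P x) - \<alpha>\<^sup>2 *\<^sub>R x))\<^sup>2 = (norm (P (P x)))\<^sup>2 - 2 * \<alpha>\<^sup>2 * (norm (P x))\<^sup>2 + \<alpha> ^ 4"
    proof -
      have "ip (P (P x)) x = (norm (P x))\<^sup>2"
        using sym by (simp add: sym_op_def cinner_self)
      then show ?thesis using x
        by (simp add: norm_diff_squared cinner_scaleR_right power_mult_distrib)
    qed
    also have "\<dots> \<le> (a * norm (P x))\<^sup>2 - 2 * \<alpha>\<^sup>2 * (norm (P x))\<^sup>2 + \<alpha> ^ 4"
      using PP by (simp add: power_mono)
    also have "\<dots> = \<alpha> ^ 4 - (2 * \<alpha>\<^sup>2 - a\<^sup>2) * (norm (P x))\<^sup>2"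
      by (simp add: algebra_simps power_mult_distrib)
    \<comment> \<open>From \<open>t < 1/4\<close> and \<open>\<alpha> \<ge> 1\<close> the
      coefficient \<open>2 * \<alpha>\<^sup>2 - a\<^sup>2\<close> is nonnegative, so
      \<open>norm (P x)\<close> may be replaced by its lower bound
      \<open>\<alpha> - t\<close>.\<close>
    also have "\<dots> \<le> \<alpha> ^ 4 - (2 * \<alpha>\<^sup>2 - a\<^sup>2) * (\<alpha> - t)\<^sup>2"
    proof -
      have "a\<^sup>2 \<le> (\<alpha> + t)\<^sup>2" using a a0 by (intro power_mono) auto
      also have "\<dots> = \<alpha>\<^sup>2 + t * (2 * \<alpha> + t)" by (simp add: power2_eq_square algebra_simps)
      also have "t * (2 * \<alpha> + t) \<le> (1/4) * (2 * \<alpha> + \<alpha>)"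
        using t a1 by (intro mult_mono) auto
      also have "\<dots> \<le> \<alpha>\<^sup>2" using a1 by (simp add: power2_eq_square)
      finally have "a\<^sup>2 \<le> 2 * \<alpha>\<^sup>2" by simp
      moreover have "(\<alpha> - t)\<^sup>2 \<le> (norm (P x))\<^sup>2" using x a1 t by (intro power_mono) auto
      ultimately show ?thesis by (simp add: mult_left_mono)
    qed
    also have "\<dots> \<le> \<alpha> ^ 4 - (2 * \<alpha>\<^sup>2 - (\<alpha> + t)\<^sup>2) * (\<alpha> - t)\<^sup>2"
    proof -
      have "a\<^sup>2 \<le> (\<alpha> + t)\<^sup>2" using a a0 by (intro power_mono) auto
      then have "(2 * \<alpha>\<^sup>2 - (\<alpha> + t)\<^sup>2) * (\<alpha> - t)\<^sup>2 \<le> (2 * \<alpha>\<^sup>2 - a\<^sup>2) * (\<alpha> - t)\<^sup>2"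
        by (intro mult_right_mono) auto
      then show ?thesis by simp
    qed
    also have "\<dots> = 4 * \<alpha> ^ 3 * t + t ^ 4 - 4 * \<alpha>\<^sup>2 * t\<^sup>2"
      by (simp add: power2_eq_square power3_eq_cube power4_eq_xxxx algebra_simps)
    also have "\<dots> \<le> 4 * \<alpha> ^ 3 * t + t ^ 4" by simp
    finally have b1: "(norm (P (P x) - \<alpha>\<^sup>2 *\<^sub>R x))\<^sup>2 \<le> 4 * \<alpha> ^ 3 * t + t ^ 4" .
    have eq: "P (P x) - \<alpha>\<^sup>2 *\<^sub>R x = P w + \<alpha> *\<^sub>R w"
      by (simp add: w_def blinfun.bilinear_simps algebra_simps power2_eq_square)
    have "norm w \<le> norm (P w + \<alpha> *\<^sub>R w)"
    proof (cases "w = 0")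
      case False
      have "norm w * norm w \<le> ip (P w) w + \<alpha> * (norm w)\<^sup>2"
        using coercive[of w] a1 by (simp add: power2_eq_square add_increasing2)
      also have "\<dots> = ip (P w + \<alpha> *\<^sub>R w) w" by (simp add: ip_simps cinner_self)
      also have "\<dots> \<le> norm (P w + \<alpha> *\<^sub>R w) * norm w" using abs_ip_le by (metis abs_le_D1)
      finally show ?thesis using False by simp
    qed simp
    then have "(norm w)\<^sup>2 \<le> (norm (P (P x) - \<alpha>\<^sup>2 *\<^sub>R x))\<^sup>2" unfolding eq by (simp add: power_mono)
    then have "(norm w)\<^sup>2 \<le> 4 * \<alpha> ^ 3 * t + t ^ 4" using b1 by linarith
    then show ?thesis using x unfolding w_def d_def by (intro exI[of _ x]) auto
  qed
  have "\<exists>x. norm x = 1 \<and> Z x < e \<and> norm (P x - \<alpha> *\<^sub>R x) < e" if e: "e > 0" for e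
  proof -
    have "((\<lambda>t. 4 * \<alpha> ^ 3 * t + t ^ 4) \<longlongrightarrow> 4 * \<alpha> ^ 3 * 0 + 0 ^ 4) (at_right 0)"
      by (intro tendsto_intros)
    then have "eventually (\<lambda>t. 4 * \<alpha> ^ 3 * t + t ^ 4 < e\<^sup>2) (at_right 0)"
      using e by (intro order_tendstoD(2)) auto
    moreover have "eventually (\<lambda>t::real. t < min (1/4) e) (at_right 0)"
      using e by (intro order_tendstoD(2)[OF tendsto_ident_at]) auto
    moreover have "eventually (\<lambda>t::real. 0 < t) (at_right 0)"
      by (rule eventually_at_right_less)
    ultimately have ev: "eventually (\<lambda>t. 0 < t \<and> t < 1/4 \<and> t < e \<and> 4 * \<alpha> ^ 3 * t + t ^ 4 < e\<^sup>2) (at_right 0)"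
      by eventually_elim auto
    then obtain t where t: "0 < t" "t < 1/4" "t < e" "4 * \<alpha> ^ 3 * t + t ^ 4 < e\<^sup>2"
      using eventually_happens'[OF trivial_limit_at_right_real ev] by blast
    obtain x where x: "norm x = 1" "Z x < t" "(norm (P x - \<alpha> *\<^sub>R x))\<^sup>2 \<le> 4 * \<alpha> ^ 3 * t + t ^ 4"
      using main[OF t(1,2)] by blast
    have "norm (P x - \<alpha> *\<^sub>R x) < e"
      using x t e by (intro power2_less_imp_less[of _ e]) auto
    then show ?thesis using x t by (intro exI[of _ x]) auto
  qed
  then show ?thesis using aq by blast
qed

text \<open>Adding \<open>norm S + 1\<close> times the identity makes the operator coercive, keeps
  its approximate eigenvectors and shifts \<open>q\<close> and \<open>\<alpha>\<close> by the same
  amount.\<close>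

lemma approx_eigenvalue:
  fixes S :: "'a :: complex_inner \<Rightarrow>\<^sub>L 'a"
  assumes sym: "sym_op S"
    and Z0: "\<And>x. 0 \<le> Z x"
    and Z_scale: "\<And>r x. Z (r *\<^sub>R x) = \<bar>r\<bar> * Z x"
    and Z_add: "\<And>x y. Z (x + y) \<le> Z x + Z y"
    and Z_S: "\<And>x. Z (S x) \<le> c * Z x"
    and ex: "\<And>e. e > 0 \<Longrightarrow> \<exists>x. norm x = 1 \<and> Z x < e \<and> q \<le> ip (S x) x"
  shows "\<exists>\<alpha>\<ge>q. \<forall>e>0. \<exists>x. norm x = 1 \<and> Z x < e \<and> norm (S x - \<alpha> *\<^sub>R x) < e"
proof -
  define m where "m = norm S + 1"
  define P where "P = S + m *\<^sub>R id_blinfun"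
  have P: "P x = S x + m *\<^sub>R x" for x
    by (simp add: P_def blinfun.bilinear_simps)
  have ipP: "ip (P x) x = ip (S x) x + m * (norm x)\<^sup>2" for x
    by (simp add: P ip_simps cinner_self)
  have "\<exists>\<alpha>\<ge>q + m. \<forall>e>0. \<exists>x. norm x = 1 \<and> Z x < e \<and> norm (P x - \<alpha> *\<^sub>R x) < e"
  proof (rule approx_eigenvalue_coercive)
    show "sym_op P" using sym by (simp add: sym_op_def P ip_simps)
    show "(norm x)\<^sup>2 \<le> ip (P x) x" for x
    proof -
      have "\<bar>ip (S x) x\<bar> \<le> norm (S x) * norm x" by (rule abs_ip_le)
      also have "\<dots> \<le> norm S * norm x * norm x"
        by (intro mult_right_mono norm_blinfun norm_ge_zero)
      finally show ?thesis unfolding ipP m_def by (simp add: power2_eq_square algebra_simps)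
    qed
    show "Z (P x) \<le> (c + \<bar>m\<bar>) * Z x" for x
      using Z_add[of "S x" "m *\<^sub>R x"] Z_S[of x] by (simp add: P Z_scale algebra_simps)
    show "\<exists>x. norm x = 1 \<and> Z x < e \<and> q + m \<le> ip (P x) x" if "e > 0" for e
      using ex[OF that] by (auto simp: ipP)
  qed (use Z0 Z_scale in auto)
  then obtain \<alpha> where "\<alpha> \<ge> q + m" "\<And>e. e > 0 \<Longrightarrow> \<exists>x. norm x = 1 \<and> Z x < e \<and> norm (P x - \<alpha> *\<^sub>R x) < e"
    by blast
  moreover have "P x - \<alpha> *\<^sub>R x = S x - (\<alpha> - m) *\<^sub>R x" for x
    by (simp add: P algebra_simps)
  ultimately show ?thesis by (intro exI[of _ "\<alpha> - m"]) auto
qed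

text \<open>The joint approximate point spectrum, placed in the plane: the real part belongs to
  \<open>A\<close>, the imaginary part to \<open>B\<close>.\<close>

definition jspec :: "('a :: complex_inner \<Rightarrow>\<^sub>L 'a) \<Rightarrow> ('a \<Rightarrow>\<^sub>L 'a) \<Rightarrow> complex set" where
  "jspec A B = {l. \<forall>e>0. \<exists>x. norm x = 1 \<and> norm (A x - Re l *\<^sub>R x) < e \<and> norm (B x - Im l *\<^sub>R x) < e}"

text \<open>\<open>is_fun A B f S\<close> says \<open>S = f(A, B)\<close>: the condition on approximate eigenvectors determines \<open>S\<close>, by
\<open>is_fun_unique\<close> below, and only the values of \<open>f\<close> on the joint spectrum matter.\<close>

definition is_fun ::
    "('a :: complex_inner \<Rightarrow>\<^sub>L 'a) \<Rightarrow> ('a \<Rightarrow>\<^sub>L 'a) \<Rightarrow> (complex \<Rightarrow> real) \<Rightarrow> ('a \<Rightarrow>\<^sub>L 'a) \<Rightarrow> bool" where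
  "is_fun A B f S \<longleftrightarrow> sym_op S \<and> (\<forall>R. commute R A \<and> commute R B \<longrightarrow> commute R S) \<and>
    (\<forall>l\<in>jspec A B. \<forall>e>0. \<exists>d>0. \<forall>x. norm x = 1 \<and> norm (A x - Re l *\<^sub>R x) < d \<and>
      norm (B x - Im l *\<^sub>R x) < d \<longrightarrow> norm (S x - f l *\<^sub>R x) < e)"

definition sym_pair :: "('a :: complex_inner \<Rightarrow>\<^sub>L 'a) \<Rightarrow> ('a \<Rightarrow>\<^sub>L 'a) \<Rightarrow> bool" where
  "sym_pair A B \<longleftrightarrow> sym_op A \<and> sym_op B \<and> commute A B"

text \<open>A negative value of the form yields an approximate eigenvalue of \<open>S\<close> that
  is at most this value. Treating \<open>S\<close>, \<open>A\<close> and \<open>B\<close> in turn,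
  each time with the earlier defects as \<open>Z\<close>, produces joint approximate eigenvectors,
  hence a point of \<open>jspec A B\<close> at which \<open>f\<close> would have to be
  negative.\<close>

lemma is_fun_nonneg:
  assumes AB: "sym_pair A B" and S: "is_fun A B f S"
    and f: "\<And>l. l \<in> jspec A B \<Longrightarrow> 0 \<le> f l"
  shows "0 \<le> ip (S x) x"
proof (rule ccontr)
  assume neg: "\<not> 0 \<le> ip (S x) x"
  have x0: "x \<noteq> 0"
  proof
    assume "x = 0"
    then show False using neg cinner_self[of "0 :: 'a"] by (simp add: blinfun.zero_right)
  qed
  define u where "u = (1 / norm x) *\<^sub>R x"
  have u: "norm u = 1" "ip (S u) u < 0"
    using neg x0 by (simp_all add: u_def blinfun.scaleR_right ip_simps divide_neg_pos mult_neg_pos)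
  have sA: "sym_op A" and sB: "sym_op B" and AB_c: "commute A B"
    using AB by (auto simp: sym_pair_def)
  have cA: "commute A S" and cB: "commute B S"
    using S AB_c by (auto simp: is_fun_def commute_def)
  have lb: "- norm R \<le> ip (R x) x" if "norm x = 1" for R :: "'a \<Rightarrow>\<^sub>L 'a" and x
  proof -
    have "\<bar>ip (R x) x\<bar> \<le> norm (R x)" using abs_ip_le[of "R x" x] that by simp
    also have "\<dots> \<le> norm R" using norm_blinfun[of R x] that by simp
    finally show ?thesis by simp
  qed
  \<comment> \<open>No operator has been treated yet, so the defect is the zero seminorm, written
    \<open>0 * norm x\<close>.\<close>
  have "\<exists>\<alpha>\<ge>- ip (S u) u. \<forall>e>0. \<exists>x. norm x = 1 \<and> 0 * norm x < e \<and> norm ((- S) x - \<alpha> *\<^sub>R x) < e"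
  proof (rule approx_eigenvalue)
    show "sym_op (- S)"
      using S by (simp add: is_fun_def sym_op_def blinfun.minus_left ip_simps)
    show "0 * norm ((- S) x) \<le> 0 * (0 * norm x)" for x by simp
    show "\<exists>x. norm x = 1 \<and> 0 * norm x < e \<and> - ip (S u) u \<le> ip ((- S) x) x" if "e > 0" for e :: real
      using u that by (intro exI[of _ u]) (simp add: blinfun.minus_left ip_simps)
  qed auto
  then obtain \<alpha> where \<alpha>_ge: "\<alpha> \<ge> - ip (S u) u" and
    ea: "\<forall>e>0. \<exists>x. norm x = 1 \<and> norm ((- S) x - \<alpha> *\<^sub>R x) < e"
    by auto
  have \<alpha>: "\<alpha> > 0" using \<alpha>_ge u by linarith
  define Z where "Z x = norm ((- S) x - \<alpha> *\<^sub>R x)" for x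
  have ZR: "Z (R x) \<le> norm R * Z x" if "commute R S" for R x
  proof -
    have "(- S) (R x) - \<alpha> *\<^sub>R R x = R ((- S) x - \<alpha> *\<^sub>R x)"
      using that by (simp add: commute_def blinfun.bilinear_simps)
    then show ?thesis unfolding Z_def by (simp add: norm_blinfun)
  qed
  have Z_scale: "Z (r *\<^sub>R x) = \<bar>r\<bar> * Z x" for r x
  proof -
    have "(- S) (r *\<^sub>R x) - \<alpha> *\<^sub>R r *\<^sub>R x = r *\<^sub>R ((- S) x - \<alpha> *\<^sub>R x)"
      by (simp add: blinfun.bilinear_simps algebra_simps)
    then show ?thesis unfolding Z_def by simp
  qed
  have Z_add: "Z (x + y) \<le> Z x + Z y" for x y
  proof -
    have "(- S) (x + y) - \<alpha> *\<^sub>R (x + y) = ((- S) x - \<alpha> *\<^sub>R x) + ((- S) y - \<alpha> *\<^sub>R y)"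
      by (simp add: blinfun.bilinear_simps algebra_simps)
    then show ?thesis unfolding Z_def by (metis norm_triangle_ineq)
  qed
  \<comment> \<open>Every unit vector satisfies the lower bound \<open>- norm A\<close>, so only
    smallness of \<open>Z\<close> has to be supplied.\<close>
  have "\<exists>r\<ge>- norm A. \<forall>e>0. \<exists>x. norm x = 1 \<and> Z x < e \<and> norm (A x - r *\<^sub>R x) < e"
    by (rule approx_eigenvalue[OF sA _ Z_scale Z_add ZR[OF cA]])
      (use ea lb in \<open>unfold Z_def, simp, blast\<close>)
  then obtain r where er: "\<And>e. e > 0 \<Longrightarrow> \<exists>x. norm x = 1 \<and> Z x < e \<and> norm (A x - r *\<^sub>R x) < e"
    by blast
  define Y where "Y x = Z x + norm (A x - r *\<^sub>R x)" for x
  have "\<exists>s\<ge>- norm B. \<forall>e>0. \<exists>x. norm x = 1 \<and> Y x < e \<and> norm (B x - s *\<^sub>R x) < e"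
  proof (rule approx_eigenvalue[OF sB])
    show "0 \<le> Y x" for x by (simp add: Y_def Z_def)
    show "Y (t *\<^sub>R x) = \<bar>t\<bar> * Y x" for t x
    proof -
      have "A (t *\<^sub>R x) - r *\<^sub>R t *\<^sub>R x = t *\<^sub>R (A x - r *\<^sub>R x)"
        by (simp add: blinfun.bilinear_simps algebra_simps)
      then have "norm (A (t *\<^sub>R x) - r *\<^sub>R t *\<^sub>R x) = \<bar>t\<bar> * norm (A x - r *\<^sub>R x)"
        by (simp only: norm_scaleR)
      then show ?thesis by (simp only: Y_def Z_scale distrib_left)
    qed
    show "Y (x + y) \<le> Y x + Y y" for x y
    proof -
      have "A (x + y) - r *\<^sub>R (x + y) = (A x - r *\<^sub>R x) + (A y - r *\<^sub>R y)"
        by (simp add: blinfun.bilinear_simps algebra_simps)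
      then have "norm (A (x + y) - r *\<^sub>R (x + y)) \<le> norm (A x - r *\<^sub>R x) + norm (A y - r *\<^sub>R y)"
        by (metis norm_triangle_ineq)
      then show ?thesis using Z_add[of x y] by (simp add: Y_def)
    qed
    show "Y (B x) \<le> norm B * Y x" for x
    proof -
      have "A (B x) - r *\<^sub>R B x = B (A x - r *\<^sub>R x)"
        using AB_c by (simp add: commute_def blinfun.bilinear_simps)
      then have "norm (A (B x) - r *\<^sub>R B x) \<le> norm B * norm (A x - r *\<^sub>R x)"
        by (simp add: norm_blinfun)
      then show ?thesis using ZR[OF cB, of x] by (simp add: Y_def algebra_simps)
    qed
    show "\<exists>x. norm x = 1 \<and> Y x < e \<and> - norm B \<le> ip (B x) x" if e: "e > 0" for e
    proof -
      obtain x where "norm x = 1 \<and> Z x < e / 2 \<and> norm (A x - r *\<^sub>R x) < e / 2"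
        using er[of "e / 2"] e by auto
      then show ?thesis using lb[of x B] by (intro exI[of _ x]) (auto simp: Y_def)
    qed
  qed
  then obtain s where es: "\<And>e. e > 0 \<Longrightarrow> \<exists>x. norm x = 1 \<and> Y x < e \<and> norm (B x - s *\<^sub>R x) < e"
    by blast
  define l where "l = Complex r s"
  have l: "l \<in> jspec A B" unfolding jspec_def
  proof safe
    fix e :: real assume "e > 0"
    then obtain x where x: "norm x = 1 \<and> Y x < e \<and> norm (B x - s *\<^sub>R x) < e" using es by blast
    have "norm (A x - r *\<^sub>R x) \<le> Y x" by (simp add: Y_def Z_def)
    then show "\<exists>x. norm x = 1 \<and> norm (A x - Re l *\<^sub>R x) < e \<and> norm (B x - Im l *\<^sub>R x) < e"
      using x unfolding l_def by auto
  qed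
  then obtain d where d: "d > 0" and dS: "\<And>x. norm x = 1 \<and> norm (A x - Re l *\<^sub>R x) < d \<and>
      norm (B x - Im l *\<^sub>R x) < d \<Longrightarrow> norm (S x - f l *\<^sub>R x) < \<alpha> / 2"
    using S \<alpha> unfolding is_fun_def by (metis half_gt_zero)
  obtain x where x: "norm x = 1" "Y x < min d (\<alpha> / 2)" "norm (B x - s *\<^sub>R x) < min d (\<alpha> / 2)"
    using es[of "min d (\<alpha> / 2)"] d \<alpha> by auto
  have "norm (A x - r *\<^sub>R x) \<le> Y x" "Z x \<le> Y x" by (simp_all add: Y_def Z_def)
  then have n1: "norm (S x - f l *\<^sub>R x) < \<alpha> / 2" and n2: "norm ((- S) x - \<alpha> *\<^sub>R x) < \<alpha> / 2"
    using dS[of x] x by (auto simp: l_def Z_def)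
  have "(S x - f l *\<^sub>R x) + ((- S) x - \<alpha> *\<^sub>R x) = (- (f l + \<alpha>)) *\<^sub>R x"
    by (simp add: blinfun.minus_left algebra_simps)
  then have "norm ((- (f l + \<alpha>)) *\<^sub>R x) \<le> norm (S x - f l *\<^sub>R x) + norm ((- S) x - \<alpha> *\<^sub>R x)"
    using norm_triangle_ineq[of "S x - f l *\<^sub>R x" "(- S) x - \<alpha> *\<^sub>R x"] by simp
  then have "\<bar>f l + \<alpha>\<bar> \<le> norm (S x - f l *\<^sub>R x) + norm ((- S) x - \<alpha> *\<^sub>R x)"
    using x by simp
  then show False using n1 n2 f[OF l] \<alpha> by simp
qed

section \<open>Functional calculus for a commuting symmetric pair\<close>

lemma is_fun_ip: "is_fun A B f S \<Longrightarrow> ip (S x) y = ip x (S y)"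
  by (simp add: is_fun_def sym_op_def)

lemma is_fun_commute_pair:
  assumes "sym_pair A B" "is_fun A B f S"
  shows "commute A S" "commute B S"
  using assms by (auto simp: is_fun_def sym_pair_def commute_def)

text \<open>By its commutant clause \<open>is_fun\<close> puts \<open>S\<close> into the commutant
  of \<open>A\<close> and \<open>B\<close>, and then the same clause for \<open>R\<close> applies to
  \<open>S\<close>. This is what makes products symmetric.\<close>

lemma is_fun_commute:
  assumes "sym_pair A B" "is_fun A B f S" "is_fun A B g R"
  shows "commute S R"
  using is_fun_commute_pair[OF assms(1,2)] assms(3)
  by (auto simp: is_fun_def intro: commute_sym)

lemma is_funI:
  assumes "sym_op S"
    and "\<And>R. commute R A \<Longrightarrow> commute R B \<Longrightarrow> commute R S"
    and "\<And>l e. l \<in> jspec A B \<Longrightarrow> e > 0 \<Longrightarrow> \<exists>d>0. \<forall>x. norm x = 1 \<and> norm (A x - Re l *\<^sub>R x) < d \<and>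
      norm (B x - Im l *\<^sub>R x) < d \<longrightarrow> norm (S x - f l *\<^sub>R x) < e"
  shows "is_fun A B f S"
  using assms unfolding is_fun_def by blast

lemma is_funD:
  assumes "is_fun A B f S" "l \<in> jspec A B" "e > 0"
  obtains d where "d > 0" "\<And>x. norm x = 1 \<Longrightarrow> norm (A x - Re l *\<^sub>R x) < d \<Longrightarrow>
      norm (B x - Im l *\<^sub>R x) < d \<Longrightarrow> norm (S x - f l *\<^sub>R x) < e"
proof -
  have "\<exists>d>0. \<forall>x. norm x = 1 \<and> norm (A x - Re l *\<^sub>R x) < d \<and>
      norm (B x - Im l *\<^sub>R x) < d \<longrightarrow> norm (S x - f l *\<^sub>R x) < e"
    using assms unfolding is_fun_def by blast
  then obtain d where "d > 0" "\<forall>x. norm x = 1 \<and> norm (A x - Re l *\<^sub>R x) < d \<and>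
      norm (B x - Im l *\<^sub>R x) < d \<longrightarrow> norm (S x - f l *\<^sub>R x) < e"
    by (elim exE conjE)
  then show thesis using that[of d] by simp
qed

lemma is_fun_cong:
  assumes "is_fun A B f S" "\<And>l. l \<in> jspec A B \<Longrightarrow> f l = g l"
  shows "is_fun A B g S"
  using assms unfolding is_fun_def by simp

lemma is_fun_const: "is_fun A B (\<lambda>_. c) (c *\<^sub>R id_blinfun)"
  by (rule is_funI) (auto simp: sym_op_def commute_def blinfun.bilinear_simps ip_simps intro!: exI[of _ 1])

lemma is_fun_Re: "sym_pair A B \<Longrightarrow> is_fun A B Re A"
  by (rule is_funI) (auto simp: sym_pair_def)

lemma is_fun_Im: "sym_pair A B \<Longrightarrow> is_fun A B Im B"
  by (rule is_funI) (auto simp: sym_pair_def)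

lemma is_fun_add:
  assumes S: "is_fun A B f S" and R: "is_fun A B g R"
  shows "is_fun A B (\<lambda>l. f l + g l) (S + R)"
proof (rule is_funI)
  show "sym_op (S + R)"
    using is_fun_ip[OF S] is_fun_ip[OF R] by (simp add: sym_op_def blinfun.add_left ip_simps)
  show "commute Q (S + R)" if "commute Q A" "commute Q B" for Q
    using S R that by (auto simp: is_fun_def commute_def blinfun.bilinear_simps)
  fix l and e :: real assume l: "l \<in> jspec A B" and e: "e > 0"
  obtain d1 where d1: "d1 > 0" "\<And>x. norm x = 1 \<Longrightarrow> norm (A x - Re l *\<^sub>R x) < d1 \<Longrightarrow>
      norm (B x - Im l *\<^sub>R x) < d1 \<Longrightarrow> norm (S x - f l *\<^sub>R x) < e / 2"
    using is_funD[OF S l half_gt_zero[OF e]] by blast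
  obtain d2 where d2: "d2 > 0" "\<And>x. norm x = 1 \<Longrightarrow> norm (A x - Re l *\<^sub>R x) < d2 \<Longrightarrow>
      norm (B x - Im l *\<^sub>R x) < d2 \<Longrightarrow> norm (R x - g l *\<^sub>R x) < e / 2"
    using is_funD[OF R l half_gt_zero[OF e]] by blast
  have "norm ((S + R) x - (f l + g l) *\<^sub>R x) < e"
    if "norm x = 1" "norm (A x - Re l *\<^sub>R x) < min d1 d2" "norm (B x - Im l *\<^sub>R x) < min d1 d2" for x
  proof -
    have "(S + R) x - (f l + g l) *\<^sub>R x = (S x - f l *\<^sub>R x) + (R x - g l *\<^sub>R x)"
      by (simp add: blinfun.add_left algebra_simps)
    then show ?thesis
      using d1(2)[of x] d2(2)[of x] that norm_triangle_ineq[of "S x - f l *\<^sub>R x" "R x - g l *\<^sub>R x"]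
      by simp
  qed
  then show "\<exists>d>0. \<forall>x. norm x = 1 \<and> norm (A x - Re l *\<^sub>R x) < d \<and>
      norm (B x - Im l *\<^sub>R x) < d \<longrightarrow> norm ((S + R) x - (f l + g l) *\<^sub>R x) < e"
    using d1 d2 by (intro exI[of _ "min d1 d2"]) auto
qed

lemma is_fun_mult:
  assumes AB: "sym_pair A B" and S: "is_fun A B f S" and R: "is_fun A B g R"
  shows "is_fun A B (\<lambda>l. f l * g l) (S o\<^sub>L R)"
proof (rule is_funI)
  show "sym_op (S o\<^sub>L R)"
    using is_fun_ip[OF S] is_fun_ip[OF R] is_fun_commute[OF AB S R] by (simp add: sym_op_def commute_def)
  show "commute Q (S o\<^sub>L R)" if "commute Q A" "commute Q B" for Q
    using S R that by (auto simp: is_fun_def commute_def)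
  fix l and e :: real assume l: "l \<in> jspec A B" and e: "e > 0"
  define e1 where "e1 = e / (2 * (norm S + 1))"
  define e2 where "e2 = e / (2 * (\<bar>g l\<bar> + 1))"
  have "norm S + 1 > 0" "\<bar>g l\<bar> + 1 > 0" by (simp_all add: add_nonneg_pos)
  then have e12: "e1 > 0" "e2 > 0" and m: "norm S * e1 \<le> e / 2" "\<bar>g l\<bar> * e2 \<le> e / 2"
    using e by (auto simp: e1_def e2_def field_simps)
  obtain d1 where d1: "d1 > 0" "\<And>x. norm x = 1 \<Longrightarrow> norm (A x - Re l *\<^sub>R x) < d1 \<Longrightarrow>
      norm (B x - Im l *\<^sub>R x) < d1 \<Longrightarrow> norm (S x - f l *\<^sub>R x) < e2 / 2"
    using is_funD[OF S l half_gt_zero[OF e12(2)]] by blast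
  obtain d2 where d2: "d2 > 0" "\<And>x. norm x = 1 \<Longrightarrow> norm (A x - Re l *\<^sub>R x) < d2 \<Longrightarrow>
      norm (B x - Im l *\<^sub>R x) < d2 \<Longrightarrow> norm (R x - g l *\<^sub>R x) < e1"
    using is_funD[OF R l e12(1)] by blast
  have "norm ((S o\<^sub>L R) x - (f l * g l) *\<^sub>R x) < e"
    if "norm x = 1" "norm (A x - Re l *\<^sub>R x) < min d1 d2" "norm (B x - Im l *\<^sub>R x) < min d1 d2" for x
  proof -
    have "(S o\<^sub>L R) x - (f l * g l) *\<^sub>R x = S (R x - g l *\<^sub>R x) + g l *\<^sub>R (S x - f l *\<^sub>R x)"
      by (simp add: blinfun.bilinear_simps algebra_simps)
    then have "norm ((S o\<^sub>L R) x - (f l * g l) *\<^sub>R x)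
        \<le> norm (S (R x - g l *\<^sub>R x)) + \<bar>g l\<bar> * norm (S x - f l *\<^sub>R x)"
      using norm_triangle_ineq[of "S (R x - g l *\<^sub>R x)" "g l *\<^sub>R (S x - f l *\<^sub>R x)"] by simp
    also have "norm (S (R x - g l *\<^sub>R x)) \<le> norm S * e1"
      using d2(2)[of x] that norm_blinfun[of S "R x - g l *\<^sub>R x"]
      by (smt (verit) min_less_iff_conj mult_left_mono norm_ge_zero)
    also have "\<bar>g l\<bar> * norm (S x - f l *\<^sub>R x) \<le> \<bar>g l\<bar> * (e2 / 2)"
      using d1(2)[of x] that by (intro mult_left_mono) auto
    also have "norm S * e1 + \<bar>g l\<bar> * (e2 / 2) \<le> e / 2 + e / 4" using m by linarith
    also have "\<dots> < e" using e by simp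
    finally show ?thesis by simp
  qed
  then show "\<exists>d>0. \<forall>x. norm x = 1 \<and> norm (A x - Re l *\<^sub>R x) < d \<and>
      norm (B x - Im l *\<^sub>R x) < d \<longrightarrow> norm ((S o\<^sub>L R) x - (f l * g l) *\<^sub>R x) < e"
    using d1 d2 by (intro exI[of _ "min d1 d2"]) auto
qed

lemma is_fun_cmult:
  assumes AB: "sym_pair A B" and S: "is_fun A B f S"
  shows "is_fun A B (\<lambda>l. c * f l) (c *\<^sub>R S)"
proof -
  have "(c *\<^sub>R id_blinfun) o\<^sub>L S = c *\<^sub>R S" by (rule blinfun_eqI) (simp add: blinfun.bilinear_simps)
  then show ?thesis using is_fun_mult[OF AB is_fun_const S, of c] by simp
qed

lemma is_fun_diff:
  assumes AB: "sym_pair A B" and S: "is_fun A B f S" and R: "is_fun A B g R"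
  shows "is_fun A B (\<lambda>l. f l - g l) (S - R)"
  using is_fun_add[OF S is_fun_cmult[OF AB R, of "-1"]] by simp

lemma is_fun_sum:
  assumes AB: "sym_pair A B" and S: "\<And>i. i \<in> I \<Longrightarrow> is_fun A B (f i) (S i)"
  shows "is_fun A B (\<lambda>l. \<Sum>i\<in>I. f i l) (\<Sum>i\<in>I. S i)"
  using S
proof (induction I rule: infinite_finite_induct)
  case (insert i I)
  then show ?case using is_fun_add[of A B "f i" "S i"] by simp
qed (use is_fun_const[of A B 0] in simp_all)

lemma is_fun_mono:
  assumes AB: "sym_pair A B" and S: "is_fun A B f S" and R: "is_fun A B g R"
    and fg: "\<And>l. l \<in> jspec A B \<Longrightarrow> f l \<le> g l"
  shows "ip (S x) x \<le> ip (R x) x"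
  using is_fun_nonneg[OF AB is_fun_diff[OF AB R S], of x] fg
  by (simp add: blinfun.diff_left ip_simps)

text \<open>The square of \<open>norm (S x)\<close> is the form of \<open>f\<^sup>2\<close>, and
  \<open>f\<^sup>2\<close> is at most the constant \<open>c\<^sup>2\<close> on the joint spectrum.
  With \<open>c = 0\<close> this gives uniqueness.\<close>

lemma is_fun_norm_le:
  assumes AB: "sym_pair A B" and S: "is_fun A B f S"
    and f: "\<And>l. l \<in> jspec A B \<Longrightarrow> \<bar>f l\<bar> \<le> c" and c: "c \<ge> 0"
  shows "norm S \<le> c"
proof (rule norm_blinfun_bound[OF c])
  fix x
  have "ip ((S o\<^sub>L S) x) x \<le> ip (((c\<^sup>2) *\<^sub>R id_blinfun) x) x"
  proof (rule is_fun_mono[OF AB is_fun_mult[OF AB S S] is_fun_const])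
    fix l assume "l \<in> jspec A B"
    then have "(f l)\<^sup>2 \<le> c\<^sup>2" using f by (simp add: abs_le_square_iff[symmetric] c)
    then show "f l * f l \<le> c\<^sup>2" by (simp add: power2_eq_square)
  qed
  then have "(norm (S x))\<^sup>2 \<le> (c * norm x)\<^sup>2"
    using is_fun_ip[OF S] by (simp add: blinfun.bilinear_simps ip_simps cinner_self power_mult_distrib)
  then show "norm (S x) \<le> c * norm x"
    by (rule power2_le_imp_le) (simp add: c)
qed

lemma is_fun_unique:
  assumes AB: "sym_pair A B" and S: "is_fun A B f S" and R: "is_fun A B f R"
  shows "S = R"
  using is_fun_norm_le[OF AB is_fun_diff[OF AB S R], of 0] by simp

lemma is_fun_norm_sq:
  assumes S: "is_fun A B f S"
  shows "(norm (S x))\<^sup>2 = ip ((S o\<^sub>L S) x) x"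
  using is_fun_ip[OF S] by (simp add: cinner_self)

lemma is_fun_affine:
  assumes AB: "sym_pair A B"
  shows "is_fun A B (\<lambda>l. inner c l + r) (Re c *\<^sub>R A + Im c *\<^sub>R B + r *\<^sub>R id_blinfun)"
  using is_fun_add[OF is_fun_add[OF is_fun_cmult[OF AB is_fun_Re[OF AB], of "Re c"]
      is_fun_cmult[OF AB is_fun_Im[OF AB], of "Im c"]] is_fun_const[of A B r]]
  by (simp add: inner_complex_def)

text \<open>Each clause of \<open>is_fun\<close> is closed under norm limits of operators combined
  with uniform limits of functions; this leads from polynomials to continuous functions.\<close>

lemma is_fun_limit:
  assumes AB: "sym_pair A B" and S: "\<And>n. is_fun A B (f n) (S n)"
    and lim: "\<And>e. e > 0 \<Longrightarrow> \<exists>n. norm (S n - R) \<le> e \<and> (\<forall>l\<in>jspec A B. \<bar>f n l - g l\<bar> \<le> e)"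
  shows "is_fun A B g R"
proof -
  show ?thesis
  proof (rule is_funI)
    show "sym_op R" unfolding sym_op_def
    proof (intro allI)
      fix x y
      have "\<bar>ip (R x) y - ip x (R y)\<bar> \<le> e" if e: "e > 0" for e
      proof -
        \<comment> \<open>The summand 1 keeps the denominator positive when \<open>x\<close> or
          \<open>y\<close> vanishes.\<close>
        define t where "t = e / (2 * norm x * norm y + 1)"
        have t: "t > 0" unfolding t_def using e by (intro divide_pos_pos) (simp_all add: add_nonneg_pos)
        obtain n where n: "norm (S n - R) \<le> t" using lim[OF t] by blast
        have d: "norm (R u - S n u) \<le> t * norm u" for u
        proof -
          have "norm (R u - S n u) \<le> norm (S n - R) * norm u"
            using norm_blinfun[of "S n - R" u] by (simp add: blinfun.diff_left norm_minus_commute)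
          then show ?thesis using n mult_right_mono[OF n norm_ge_zero[of u]] by linarith
        qed
        have "ip (R x) y - ip x (R y) = ip (R x - S n x) y - ip x (R y - S n y)"
          using is_fun_ip[OF S, of n x y] by (simp add: ip_simps)
        then have "\<bar>ip (R x) y - ip x (R y)\<bar> \<le> norm (R x - S n x) * norm y + norm x * norm (R y - S n y)"
          using abs_ip_le[of "R x - S n x" y] abs_ip_le[of x "R y - S n y"] by linarith
        also have "\<dots> \<le> (t * norm x) * norm y + norm x * (t * norm y)"
          by (intro add_mono mult_right_mono mult_left_mono d) auto
        also have "\<dots> = t * (2 * norm x * norm y)" by simp
        also have "\<dots> \<le> t * (2 * norm x * norm y + 1)" using t by simp
        also have "\<dots> = e"
        proof -
          have "2 * norm x * norm y + 1 > 0" by (simp add: add_nonneg_pos)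
          then show ?thesis by (simp add: t_def)
        qed
        finally show ?thesis .
      qed
      then have "\<bar>ip (R x) y - ip x (R y)\<bar> \<le> 0" by (rule field_le_epsilon[of _ 0, simplified])
      then show "ip (R x) y = ip x (R y)" by simp
    qed
    show "commute Q R" if Q: "commute Q A" "commute Q B" for Q
      unfolding commute_def
    proof
      fix x
      have QS: "Q (S n x) = S n (Q x)" for n
        using S[of n] Q by (auto simp: is_fun_def commute_def)
      have "norm (Q (R x) - R (Q x)) \<le> e" if e: "e > 0" for e
      proof -
        define t where "t = e / (2 * norm Q * norm x + 1)"
        have t: "t > 0" unfolding t_def using e by (intro divide_pos_pos) (simp_all add: add_nonneg_pos)
        obtain n where n: "norm (S n - R) \<le> t" using lim[OF t] by blast
        have d: "norm (R u - S n u) \<le> t * norm u" for u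
        proof -
          have "norm (R u - S n u) \<le> norm (S n - R) * norm u"
            using norm_blinfun[of "S n - R" u] by (simp add: blinfun.diff_left norm_minus_commute)
          then show ?thesis using n mult_right_mono[OF n norm_ge_zero[of u]] by linarith
        qed
        have eq: "Q (R x) - R (Q x) = Q (R x - S n x) - (R (Q x) - S n (Q x))"
          by (simp add: QS blinfun.diff_right)
        have "norm (Q (R x) - R (Q x)) \<le> norm (Q (R x - S n x)) + norm (R (Q x) - S n (Q x))"
          unfolding eq by (rule norm_triangle_ineq4)
        also have "\<dots> \<le> norm Q * (t * norm x) + t * (norm Q * norm x)"
        proof (rule add_mono)
          show "norm (Q (R x - S n x)) \<le> norm Q * (t * norm x)"
            using norm_blinfun[of Q "R x - S n x"] mult_left_mono[OF d[of x] norm_ge_zero[of Q]] by linarith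
          show "norm (R (Q x) - S n (Q x)) \<le> t * (norm Q * norm x)"
            using d[of "Q x"] mult_left_mono[OF norm_blinfun[of Q x], of t] t by linarith
        qed
        also have "\<dots> = t * (2 * norm Q * norm x)" by simp
        also have "\<dots> \<le> t * (2 * norm Q * norm x + 1)" using t by simp
        also have "\<dots> = e"
        proof -
          have "2 * norm Q * norm x + 1 > 0" by (simp add: add_nonneg_pos)
          then show ?thesis by (simp add: t_def)
        qed
        finally show ?thesis .
      qed
      then have "norm (Q (R x) - R (Q x)) \<le> 0" by (rule field_le_epsilon[of _ 0, simplified])
      then show "Q (R x) = R (Q x)" by simp
    qed
    fix l and e :: real assume l: "l \<in> jspec A B" and e: "e > 0"
    obtain n where n: "norm (S n - R) \<le> e / 4" "\<bar>f n l - g l\<bar> \<le> e / 4" using lim[of "e / 4"] e l by auto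
    obtain d where d: "d > 0" "\<And>x. norm x = 1 \<Longrightarrow> norm (A x - Re l *\<^sub>R x) < d \<Longrightarrow>
        norm (B x - Im l *\<^sub>R x) < d \<Longrightarrow> norm (S n x - f n l *\<^sub>R x) < e / 2"
      using is_funD[OF S l half_gt_zero[OF e]] by blast
    have "norm (R x - g l *\<^sub>R x) < e"
      if x: "norm x = 1" "norm (A x - Re l *\<^sub>R x) < d" "norm (B x - Im l *\<^sub>R x) < d" for x
    proof -
      have "R x - g l *\<^sub>R x = (S n x - f n l *\<^sub>R x) + (f n l - g l) *\<^sub>R x - (S n - R) x"
        by (simp add: blinfun.diff_left algebra_simps)
      then have "norm (R x - g l *\<^sub>R x)
          \<le> norm (S n x - f n l *\<^sub>R x) + norm ((f n l - g l) *\<^sub>R x) + norm ((S n - R) x)"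
        using norm_triangle_ineq4[of "(S n x - f n l *\<^sub>R x) + (f n l - g l) *\<^sub>R x" "(S n - R) x"]
          norm_triangle_ineq[of "S n x - f n l *\<^sub>R x" "(f n l - g l) *\<^sub>R x"] by simp
      moreover have "norm ((S n - R) x) \<le> e / 4" using norm_blinfun[of "S n - R" x] x n by simp
      moreover have "norm (S n x - f n l *\<^sub>R x) < e / 2" using d(2) x by blast
      ultimately show ?thesis using x n by simp
    qed
    then show "\<exists>d>0. \<forall>x. norm x = 1 \<and> norm (A x - Re l *\<^sub>R x) < d \<and>
        norm (B x - Im l *\<^sub>R x) < d \<longrightarrow> norm (R x - g l *\<^sub>R x) < e"
      using d by blast
  qed
qed

text \<open>Induction over the class used by Stone--Weierstrass. Its generators are real-linear
  functionals on the plane, that is, inner products with a fixed vector.\<close>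

lemma is_fun_polynomial:
  assumes AB: "sym_pair A B"
  shows "real_polynomial_function p \<Longrightarrow> \<exists>S. is_fun A B p S"
proof (induction p rule: real_polynomial_function.induct)
  case (linear p)
  then interpret bounded_linear p .
  have "p l = inner (Complex (p 1) (p \<i>)) l + 0" for l
  proof -
    have "l = Re l *\<^sub>R 1 + Im l *\<^sub>R \<i>" by (simp add: complex_eq_iff)
    then have "p l = p (Re l *\<^sub>R 1 + Im l *\<^sub>R \<i>)" by (rule arg_cong)
    also have "\<dots> = Re l * p 1 + Im l * p \<i>" by (simp only: add scaleR real_scaleR_def)
    finally show ?thesis by (simp add: inner_complex_def)
  qed
  then have "p = (\<lambda>l. inner (Complex (p 1) (p \<i>)) l + 0)" by (rule ext)
  moreover have "\<exists>S. is_fun A B (\<lambda>l. inner (Complex (p 1) (p \<i>)) l + 0) S"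
    using is_fun_affine[OF AB] by blast
  ultimately show ?case by metis
qed (use is_fun_const is_fun_add is_fun_mult[OF AB] in blast)+

lemma compact_jspec: "compact (jspec A B)"
proof -
  have "closed (jspec A B)"
    unfolding closed_sequential_limits
  proof (intro allI impI, elim conjE)
    fix s l assume s: "\<forall>n. s n \<in> jspec A B" and l: "s \<longlonglongrightarrow> l"
    show "l \<in> jspec A B" unfolding jspec_def mem_Collect_eq
    proof (intro allI impI)
      fix e :: real assume e: "e > 0"
      obtain n where "dist (s n) l < e / 2"
        using l half_gt_zero[OF e] by (meson lim_sequentially order_refl)
      then have n: "\<bar>Re (s n) - Re l\<bar> < e / 2" "\<bar>Im (s n) - Im l\<bar> < e / 2"
        using abs_Re_le_cmod[of "s n - l"] abs_Im_le_cmod[of "s n - l"] by (auto simp: dist_norm)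
      obtain x where x: "norm x = 1" "norm (A x - Re (s n) *\<^sub>R x) < e / 2" "norm (B x - Im (s n) *\<^sub>R x) < e / 2"
        using s half_gt_zero[OF e] unfolding jspec_def by blast
      have tri: "norm (R x - r *\<^sub>R x) < e"
        if "norm (R x - q *\<^sub>R x) < e / 2" "\<bar>q - r\<bar> < e / 2" for R :: "'a \<Rightarrow>\<^sub>L 'a" and q r
      proof -
        have eq: "R x - r *\<^sub>R x = (R x - q *\<^sub>R x) + (q - r) *\<^sub>R x" by (simp add: algebra_simps)
        show ?thesis unfolding eq
          using that x(1) norm_triangle_ineq[of "R x - q *\<^sub>R x" "(q - r) *\<^sub>R x"] by simp
      qed
      show "\<exists>x. norm x = 1 \<and> norm (A x - Re l *\<^sub>R x) < e \<and> norm (B x - Im l *\<^sub>R x) < e"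
        using x n tri by blast
    qed
  qed
  moreover have "bounded (jspec A B)"
  proof -
    have bd: "\<bar>r\<bar> \<le> norm R + 1" if "norm x = 1" "norm (R x - r *\<^sub>R x) < 1" for R :: "'a \<Rightarrow>\<^sub>L 'a" and r x
    proof -
      have "\<bar>r\<bar> = norm (r *\<^sub>R x)" using that by simp
      also have "\<dots> \<le> norm (R x) + norm (R x - r *\<^sub>R x)"
        by (metis add_diff_cancel_left' diff_add_cancel norm_triangle_ineq4)
      also have "\<dots> \<le> norm R + 1" using that norm_blinfun[of R x] by simp
      finally show ?thesis .
    qed
    have "cmod l \<le> (norm A + 1) + (norm B + 1)" if l: "l \<in> jspec A B" for l
    proof -
      obtain x where "norm x = 1 \<and> norm (A x - Re l *\<^sub>R x) < 1 \<and> norm (B x - Im l *\<^sub>R x) < 1"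
        using l unfolding jspec_def mem_Collect_eq using zero_less_one by blast
      then show ?thesis using bd[of x A "Re l"] bd[of x B "Im l"] cmod_le[of l] by linarith
    qed
    then show ?thesis by (rule boundedI)
  qed
  ultimately show ?thesis by (simp add: compact_eq_bounded_closed)
qed

text \<open>Polynomials approximate \<open>f\<close> uniformly on the compact joint spectrum;
  \<open>is_fun_norm_le\<close> turns this into a Cauchy sequence of operators, which converges by
  completeness.\<close>

lemma is_fun_exists:
  fixes A B :: "'a :: complex_hilbert_space \<Rightarrow>\<^sub>L 'a"
  assumes AB: "sym_pair A B" and f: "continuous_on (jspec A B) f"
  shows "\<exists>S. is_fun A B f S"
proof -
  have "\<exists>p S. is_fun A B p S \<and> (\<forall>l\<in>jspec A B. \<bar>f l - p l\<bar> < 1 / real (Suc n))" for n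
    using Stone_Weierstrass_real_polynomial_function[OF compact_jspec f, of "1 / real (Suc n)"]
      is_fun_polynomial[OF AB] by (metis divide_pos_pos of_nat_0_less_iff zero_less_Suc zero_less_one)
  then obtain p S where S: "\<And>n. is_fun A B (p n) (S n)"
    and p: "\<And>n l. l \<in> jspec A B \<Longrightarrow> \<bar>f l - p n l\<bar> < 1 / real (Suc n)"
    by metis
  have small: "1 / real (Suc n) \<le> 1 / real (Suc N)" if "n \<ge> N" for n N
    using that by (intro divide_left_mono) auto
  have dist: "norm (S m - S n) \<le> 2 / real (Suc N)" if "m \<ge> N" "n \<ge> N" for m n N
  proof (rule is_fun_norm_le[OF AB is_fun_diff[OF AB S S]])
    show "\<bar>p m l - p n l\<bar> \<le> 2 / real (Suc N)" if "l \<in> jspec A B" for l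
      using p[OF that, of m] p[OF that, of n] small[OF \<open>m \<ge> N\<close>] small[OF \<open>n \<ge> N\<close>] by linarith
  qed simp
  have big: "\<exists>N. 2 / real (Suc N) < e" if "e > 0" for e
  proof -
    obtain N where "inverse (real (Suc N)) < e / 2" using reals_Archimedean[of "e / 2"] \<open>e > 0\<close> by auto
    then show ?thesis by (intro exI[of _ N]) (simp add: field_simps)
  qed
  have "Cauchy S"
  proof (rule CauchyI)
    fix e :: real assume "e > 0"
    then obtain N where "2 / real (Suc N) < e" using big by blast
    then show "\<exists>M. \<forall>m\<ge>M. \<forall>n\<ge>M. norm (S m - S n) < e"
      using dist by (intro exI[of _ N]) (meson order.strict_trans1)
  qed
  then obtain R where R: "S \<longlonglongrightarrow> R" using Cauchy_convergent convergentD by blast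
  have "is_fun A B f R"
  proof (rule is_fun_limit[OF AB S])
    fix e :: real assume e: "e > 0"
    obtain N where N: "2 / real (Suc N) < e" using big e by blast
    have "eventually (\<lambda>n. dist (S n) R < e) sequentially" using R e by (rule tendstoD)
    then have "eventually (\<lambda>n. dist (S n) R < e \<and> n \<ge> N) sequentially"
      using eventually_ge_at_top[of N] by eventually_elim simp
    then obtain n where n: "dist (S n) R < e" "n \<ge> N" using eventually_happens by fastforce
    have "\<bar>p n l - f l\<bar> \<le> e" if "l \<in> jspec A B" for l
      using p[OF that, of n] small[OF n(2)] N by (simp add: abs_minus_commute)
    then show "\<exists>n. norm (S n - R) \<le> e \<and> (\<forall>l\<in>jspec A B. \<bar>p n l - f l\<bar> \<le> e)"
      using n by (intro exI[of _ n]) (auto simp: dist_norm)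
  qed
  then show ?thesis by blast
qed

section \<open>Small covers by supporting strips\<close>

text \<open>A triple \<open>(c, r, \<eta>)\<close> encodes the strip where the affine function
  \<open>inner c z + r\<close> is below \<open>\<eta>\<close>. The total height is the quantity that
  Cauchy--Schwarz uses in \<open>separation\<close>.\<close>

definition cover :: "complex set \<Rightarrow> complex set \<Rightarrow> complex set \<Rightarrow> real \<Rightarrow> bool" where
  "cover K C B e \<longleftrightarrow> (\<exists>I :: (complex \<times> real \<times> real) set. finite I \<and>
    (\<forall>(c, r, \<eta>)\<in>I. 0 \<le> \<eta> \<and> (\<forall>z\<in>K. 0 \<le> inner c z + r) \<and> (\<forall>z\<in>C. 1 \<le> inner c z + r)) \<and>
    (\<forall>z\<in>B. \<exists>(c, r, \<eta>)\<in>I. inner c z + r < \<eta>) \<and> (\<Sum>(c, r, \<eta>)\<in>I. \<eta>) \<le> e)"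

text \<open>Passing from an indexed family to a set of triples merges equal triples; as heights are
  nonnegative, the sum can only drop.\<close>

lemma coverI:
  fixes c :: "'i \<Rightarrow> complex"
  assumes J: "finite J"
    and pos: "\<And>j. j \<in> J \<Longrightarrow> 0 \<le> \<eta> j"
    and K: "\<And>j z. j \<in> J \<Longrightarrow> z \<in> K \<Longrightarrow> 0 \<le> inner (c j) z + r j"
    and C: "\<And>j z. j \<in> J \<Longrightarrow> z \<in> C \<Longrightarrow> 1 \<le> inner (c j) z + r j"
    and B: "\<And>z. z \<in> B \<Longrightarrow> \<exists>j\<in>J. inner (c j) z + r j < \<eta> j"
    and sum: "(\<Sum>j\<in>J. \<eta> j) \<le> e"
  shows "cover K C B e"
proof -
  let ?I = "(\<lambda>j. (c j, r j, \<eta> j)) ` J"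
  have "(\<Sum>(c, r, \<eta>)\<in>?I. \<eta>) \<le> (\<Sum>j\<in>J. case (c j, r j, \<eta> j) of (c, r, \<eta>) \<Rightarrow> \<eta>)"
    using sum_image_le[of J "\<lambda>(c, r, \<eta>). \<eta>" "\<lambda>j. (c j, r j, \<eta> j)"] J pos by (simp add: o_def)
  then have "(\<Sum>(c, r, \<eta>)\<in>?I. \<eta>) \<le> e" using sum by simp
  moreover have "\<forall>z\<in>B. \<exists>(c, r, \<eta>)\<in>?I. inner c z + r < \<eta>" using B by fastforce
  ultimately show ?thesis
    unfolding cover_def using J pos K C by (intro exI[of _ ?I]) auto
qed

lemma cover_mono: "cover K C B e \<Longrightarrow> B' \<subseteq> B \<Longrightarrow> cover K C B' e"
  unfolding cover_def by blast

lemma cover_le: "cover K C B e \<Longrightarrow> e \<le> e' \<Longrightarrow> cover K C B e'"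
  unfolding cover_def by (meson order_trans)

lemma cover_empty: "cover K C {} 0"
  unfolding cover_def by (intro exI[of _ "{}"]) simp

lemma cover_Un:
  assumes "cover K C B1 e1" "cover K C B2 e2"
  shows "cover K C (B1 \<union> B2) (e1 + e2)"
proof -
  let ?s = "\<lambda>I :: (complex \<times> real \<times> real) set. \<Sum>(c, r, \<eta>)\<in>I. \<eta>"
  let ?P = "\<lambda>I :: (complex \<times> real \<times> real) set. \<forall>(c, r, \<eta>)\<in>I. 0 \<le> \<eta> \<and>
    (\<forall>z\<in>K. 0 \<le> inner c z + r) \<and> (\<forall>z\<in>C. 1 \<le> inner c z + r)"
  obtain I1 where I1: "finite I1" "?P I1" "\<forall>z\<in>B1. \<exists>(c, r, \<eta>)\<in>I1. inner c z + r < \<eta>" "?s I1 \<le> e1"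
    using assms(1) unfolding cover_def by blast
  obtain I2 where I2: "finite I2" "?P I2" "\<forall>z\<in>B2. \<exists>(c, r, \<eta>)\<in>I2. inner c z + r < \<eta>" "?s I2 \<le> e2"
    using assms(2) unfolding cover_def by blast
  have "?s (I1 \<inter> I2) \<ge> 0" using I1(2) by (intro sum_nonneg) auto
  then have "?s (I1 \<union> I2) \<le> e1 + e2"
    using sum.union_inter[OF I1(1) I2(1), of "\<lambda>(c, r, \<eta>). \<eta>"] I1(4) I2(4) by linarith
  moreover have "?P (I1 \<union> I2)" using I1(2) I2(2) by blast
  moreover have "\<forall>z\<in>B1 \<union> B2. \<exists>(c, r, \<eta>)\<in>I1 \<union> I2. inner c z + r < \<eta>"
    using I1(3) I2(3) by blast
  ultimately show ?thesis
    unfolding cover_def using I1(1) I2(1) by (intro exI[of _ "I1 \<union> I2"] conjI) auto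
qed

lemma cover_UN:
  assumes "finite L" "\<And>l. l \<in> L \<Longrightarrow> cover K C (U l) e"
  shows "cover K C (\<Union>l\<in>L. U l) (real (card L) * e)"
  using assms
proof (induction L)
  case empty
  then show ?case using cover_empty by simp
next
  case (insert l L)
  then have "cover K C (U l \<union> (\<Union>l\<in>L. U l)) (e + real (card L) * e)" by (intro cover_Un) auto
  then show ?case using insert by (simp add: algebra_simps)
qed

text \<open>The three points lie on one line, and the real parts are strictly ordered, so they
  determine the position on this line.\<close>

lemma mem_open_segment_of_level:
  assumes c: "c \<noteq> 0" and l: "inner c z = inner c l" "inner c w = inner c l"
    and Re: "Re z < Re l" "Re l < Re w"
  shows "l \<in> open_segment z w"
proof -
  define t where "t = (Re l - Re z) / (Re w - Re z)"
  have t: "0 < t" "t < 1" using Re by (auto simp: t_def)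
  have tw: "t * (Re w - Re z) = Re l - Re z" using Re by (simp add: t_def)
  have e1: "Re c * (Re l - Re z) + Im c * (Im l - Im z) = 0"
    and e2: "Re c * (Re w - Re z) + Im c * (Im w - Im z) = 0"
    using l by (simp_all add: inner_complex_def algebra_simps)
  have "Im c \<noteq> 0"
    using e1 c Re by (auto simp: complex_eq_iff)
  moreover have "Im c * (Im l - Im z) = Im c * (t * (Im w - Im z))"
  proof -
    have "Im c * (t * (Im w - Im z)) = - Re c * (t * (Re w - Re z))" using e2 by algebra
    then show ?thesis using e1 tw by simp
  qed
  ultimately have ti: "t * (Im w - Im z) = Im l - Im z" by simp
  have "l = (1 - t) *\<^sub>R z + t *\<^sub>R w"
    using tw ti by (simp add: complex_eq_iff algebra_simps)
  then show ?thesis using t Re by (auto simp: in_segment)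
qed

text \<open>The point \<open>q\<close> of the edge from \<open>z\<close> to \<open>w\<close> has the
  real part of \<open>z'\<close>. As \<open>c\<close> and \<open>c'\<close> support \<open>K\<close>
  from the same vertical side, neither \<open>q\<close> nor \<open>z'\<close> can lie strictly
  inside of the other, so \<open>q = z'\<close>; being extreme, \<open>z'\<close> is the end
  \<open>z\<close> of the edge.\<close>

lemma edge_endpoint_unique:
  assumes K: "convex K" and z': "z' extreme_point_of K"
    and zw: "z \<in> K" "w \<in> K" and cc: "Im c * Im c' > 0"
    and c: "\<And>v. v \<in> K \<Longrightarrow> inner c v \<le> inner c z" "inner c w = inner c z"
    and c': "\<And>v. v \<in> K \<Longrightarrow> inner c' v \<le> inner c' z'"
    and Re: "Re z \<le> Re z'" "Re z' < Re w"
  shows "z = z'"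
proof -
  define t where "t = (Re z' - Re z) / (Re w - Re z)"
  have t: "0 \<le> t" "t < 1" using Re by (auto simp: t_def)
  have tw: "t * (Re w - Re z) = Re z' - Re z" using Re by (simp add: t_def)
  define q where "q = (1 - t) *\<^sub>R z + t *\<^sub>R w"
  have qK: "q \<in> K" unfolding q_def using t zw K by (intro convexD) auto
  have Req: "Re q = Re z'" using tw by (simp add: q_def algebra_simps)
  have "inner c q = inner c z"
    by (simp add: q_def inner_add_right c(2) algebra_simps)
  moreover have "inner c z' \<le> inner c z" using c(1) z' by (simp add: extreme_point_of_def)
  ultimately have "Im c * (Im q - Im z') \<ge> 0" using Req by (simp add: inner_complex_def algebra_simps)
  moreover have "Im c' * (Im q - Im z') \<le> 0"
    using c'[OF qK] Req by (simp add: inner_complex_def algebra_simps)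
  ultimately have "Im q = Im z'"
    using cc by (auto simp: zero_less_mult_iff mult_le_0_iff zero_le_mult_iff)
  then have qz: "q = z'" using Req by (simp add: complex_eq_iff)
  show ?thesis
  proof (cases "t = 0")
    case True
    then show ?thesis using qz by (simp add: q_def)
  next
    case False
    have "z \<noteq> w" using Re by auto
    then have "z' \<in> open_segment z w"
      unfolding in_segment using t False qz by (intro conjI exI[of _ t]) (auto simp: q_def)
    then show ?thesis using z' zw by (auto simp: extreme_point_of_def)
  qed
qed

text \<open>The sign \<open>s\<close> of \<open>Im c\<close> distinguishes the upper and the lower
  boundary, and each contributes at most one point. A vertical edge (\<open>Im c = 0\<close>) cannot
  pass from \<open>Re z \<le> a\<close> to \<open>Re w \<ge> b\<close>.\<close>

lemma finite_edge_endpoints: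
  assumes K: "convex K" and ab: "a < b"
  shows "finite {z. z extreme_point_of K \<and> Re z \<le> a \<and> (\<exists>c w. c \<noteq> 0 \<and> w \<in> K \<and> b \<le> Re w \<and>
    (\<forall>v\<in>K. inner c v \<le> inner c z) \<and> inner c w = inner c z)}" (is "finite ?S")
proof -
  define Q where "Q s z \<longleftrightarrow> z extreme_point_of K \<and> Re z \<le> a \<and> (\<exists>c w. s * Im c > 0 \<and> w \<in> K \<and> b \<le> Re w \<and>
    (\<forall>v\<in>K. inner c v \<le> inner c z) \<and> inner c w = inner c z)" for s :: real and z
  have le: "z = z'" if Q1: "Q s z" and Q2: "Q s z'" and Re_le: "Re z \<le> Re z'" for s z z'
  proof -
    obtain c w where c: "s * Im c > 0" "w \<in> K" "b \<le> Re w" "\<forall>v\<in>K. inner c v \<le> inner c z" "inner c w = inner c z"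
      using Q1 unfolding Q_def by blast
    obtain c' where c': "s * Im c' > 0" "\<forall>v\<in>K. inner c' v \<le> inner c' z'"
      using Q2 unfolding Q_def by blast
    have "Im c * Im c' > 0" using c(1) c'(1) by (auto simp: zero_less_mult_iff)
    then show ?thesis
      using edge_endpoint_unique[OF K, of z' z w c c'] c c' Q1 Q2 Re_le ab
      by (auto simp: Q_def extreme_point_of_def)
  qed
  have fin: "finite {z. Q s z}" for s
  proof (cases "\<exists>z. Q s z")
    case True
    then obtain z where z: "Q s z" by blast
    have "z' = z" if "Q s z'" for z'
      using le[OF z that] le[OF that z] by (cases "Re z \<le> Re z'") auto
    then have "{z. Q s z} \<subseteq> {z}" by auto
    then show ?thesis by (rule finite_subset) simp
  qed simp
  have "?S \<subseteq> {z. Q 1 z} \<union> {z. Q (-1) z}"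
  proof
    fix z assume "z \<in> ?S"
    then obtain c w where z: "z extreme_point_of K" "Re z \<le> a" and
      c: "c \<noteq> 0" "w \<in> K" "b \<le> Re w" "\<forall>v\<in>K. inner c v \<le> inner c z" "inner c w = inner c z" by blast
    have "Im c \<noteq> 0"
    proof
      assume "Im c = 0"
      then have "Re c * (Re w - Re z) = 0" "Re c \<noteq> 0"
        using c by (auto simp: inner_complex_def algebra_simps complex_eq_iff)
      then show False using z c ab by simp
    qed
    then consider "1 * Im c > 0" | "(-1) * Im c > 0" by linarith
    then show "z \<in> {z. Q 1 z} \<union> {z. Q (-1) z}"
    proof cases
      case 1
      then have "Q 1 z" unfolding Q_def using z c by blast
      then show ?thesis by simp
    next
      case 2
      then have "Q (-1) z" unfolding Q_def using z c by blast
      then show ?thesis by simp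
    qed
  qed
  then show ?thesis by (rule finite_subset) (simp add: fin)
qed

text \<open>The supporting function of the edge alone does not separate \<open>l\<close> from \<open>w\<close>. A large multiple of it,
tilted by \<open>Re z - Re l\<close>, does: where the tilt is negative the edge has ended, as \<open>l\<close> is extreme.\<close>

lemma cover_edge_endpoint:
  assumes K: "compact K" and l: "l extreme_point_of K" and c0: "c \<noteq> 0"
    and c: "\<And>v. v \<in> K \<Longrightarrow> inner c v \<le> inner c l" and w: "w \<in> K" "inner c w = inner c l" "b \<le> Re w"
    and lb: "Re l < b" and e: "e > 0"
  shows "\<exists>U. open U \<and> l \<in> U \<and> cover K {z \<in> K. b \<le> Re z} U e"
proof -
  define d where "d = b - Re l"
  have d: "d > 0" using lb by (simp add: d_def)
  obtain R where R: "\<And>z. z \<in> K \<Longrightarrow> norm z \<le> R" using compact_imp_bounded[OF K] bounded_iff by metis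
  have lK: "l \<in> K" using l by (simp add: extreme_point_of_def)
  \<comment> \<open>Where the tilt, divided by \<open>d\<close>, can exceed the reserve
    \<open>e / 2\<close> in \<open>h\<close>; on this compact set the supporting function stays away
    from its maximum.\<close>
  define D where "D = {z \<in> K. Re z \<le> Re l - d * e / 2}"
  have cD: "compact D"
  proof -
    have "D = K \<inter> {z. Re z \<le> Re l - d * e / 2}" by (auto simp: D_def)
    then show ?thesis using K closed_halfspace_Re_le by (simp add: compact_Int_closed)
  qed
  have gap: "inner c z < inner c l" if z: "z \<in> D" for z
  proof (rule ccontr)
    assume "\<not> inner c z < inner c l"
    then have eq: "inner c z = inner c l" using c[of z] z by (auto simp: D_def)
    have "d * e / 2 > 0" using d e by simp
    then have "Re z < Re l" using z unfolding D_def mem_Collect_eq by linarith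
    then have "l \<in> open_segment z w"
      using mem_open_segment_of_level[OF c0 eq w(2)] w lb by simp
    then show False using l z w by (auto simp: extreme_point_of_def D_def)
  qed
  have "\<exists>\<kappa>>0. \<forall>z\<in>D. \<kappa> \<le> inner c l - inner c z"
  proof (cases "D = {}")
    case True
    then show ?thesis by (intro exI[of _ 1]) simp
  next
    case False
    have "continuous_on D (\<lambda>z. inner c l - inner c z)" by (intro continuous_intros)
    then obtain z0 where "z0 \<in> D" "\<forall>z\<in>D. inner c l - inner c z0 \<le> inner c l - inner c z"
      using continuous_attains_inf[OF cD False] by blast
    then show ?thesis using gap by (intro exI[of _ "inner c l - inner c z0"]) auto
  qed
  then obtain \<kappa> where \<kappa>: "\<kappa> > 0" "\<And>z. z \<in> D \<Longrightarrow> \<kappa> \<le> inner c l - inner c z" by blast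
  \<comment> \<open>On \<open>D\<close> the multiple of the supporting function is then at least
    \<open>2 * R\<close>, which outweighs the tilt.\<close>
  define M where "M = 2 * R / \<kappa>"
  have R0: "R \<ge> 0" using R[OF lK] norm_ge_zero[of l] by linarith
  have M: "M \<ge> 0" using R0 \<kappa> by (simp add: M_def)
  \<comment> \<open>Division by \<open>d\<close> makes the tilt at least 1 on the far slab. The
    constant \<open>e / 2\<close> keeps \<open>h\<close> nonnegative off \<open>D\<close> while
    \<open>h l = e / 2 < e\<close>.\<close>
  define h where "h z = (M * (inner c l - inner c z) + (Re z - Re l)) / d + e / 2" for z
  have h_affine: "h z = inner ((1 / d) *\<^sub>R (complex_of_real 1 - M *\<^sub>R c)) z + ((M * inner c l - Re l) / d + e / 2)" for z
    using d by (simp add: h_def inner_diff_left divide_simps) (simp add: inner_complex_def algebra_simps)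
  define U where "U = {z. h z < e}"
  have "open U" unfolding U_def h_affine by (intro open_Collect_less continuous_intros)
  moreover have "l \<in> U" using e by (simp add: U_def h_def)
  moreover have "cover K {z \<in> K. b \<le> Re z} U e"
  proof (rule coverI[where J = "{()}" and \<eta> = "\<lambda>_. e" and c = "\<lambda>_. (1 / d) *\<^sub>R (complex_of_real 1 - M *\<^sub>R c)"
        and r = "\<lambda>_. (M * inner c l - Re l) / d + e / 2"], goal_cases)
    case (3 j z)
    have "0 \<le> h z"
    proof (cases "z \<in> D")
      case True
      have "\<bar>Re z\<bar> \<le> R" "\<bar>Re l\<bar> \<le> R" using R[OF 3(2)] R[OF lK] abs_Re_le_cmod[of z] abs_Re_le_cmod[of l] by auto
      moreover have "2 * R \<le> M * (inner c l - inner c z)"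
        using \<kappa> M mult_left_mono[OF \<kappa>(2)[OF True] M] by (simp add: M_def)
      ultimately have "0 \<le> M * (inner c l - inner c z) + (Re z - Re l)" by linarith
      then show ?thesis using d e by (simp add: h_def)
    next
      case False
      then have "Re z - Re l \<ge> - (d * e / 2)" using 3 by (auto simp: D_def)
      moreover have "0 \<le> M * (inner c l - inner c z)" using M c[OF 3(2)] by simp
      ultimately have "M * (inner c l - inner c z) + (Re z - Re l) \<ge> - (d * e / 2)" by linarith
      then have "(M * (inner c l - inner c z) + (Re z - Re l)) / d \<ge> - (d * e / 2) / d"
        using d by (intro divide_right_mono) auto
      then show ?thesis using d by (simp add: h_def)
    qed
    then show ?case by (simp only: h_affine)
  next
    case (4 j z)
    have "0 \<le> M * (inner c l - inner c z)" using M c[of z] 4 by simp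
    then have "d \<le> M * (inner c l - inner c z) + (Re z - Re l)" using 4 by (simp add: d_def)
    then have "1 \<le> (M * (inner c l - inner c z) + (Re z - Re l)) / d" using d by simp
    then have "1 \<le> h z" using e by (simp add: h_def)
    then show ?case by (simp only: h_affine)
  next
    case (5 z)
    then show ?case unfolding U_def mem_Collect_eq h_affine by blast
  qed (use e in auto)
  ultimately show ?thesis by blast
qed

text \<open>Compactness: violations for \<open>\<kappa> = 1 / (n + 1)\<close> accumulate at a
  direction for which a point of \<open>B\<close> and a point of \<open>C\<close> both maximize over
  \<open>K\<close>.\<close>

lemma uniform_support_gap:
  fixes c1 c2 :: complex
  defines "\<psi> \<equiv> \<lambda>t. (1 - t) *\<^sub>R c1 + t *\<^sub>R c2"
  assumes B: "compact B" and C: "compact C"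
    and no: "\<And>t z w. t \<in> {0..1} \<Longrightarrow> z \<in> B \<Longrightarrow> w \<in> C \<Longrightarrow>
      \<exists>v\<in>K. inner (\<psi> t) z < inner (\<psi> t) v \<or> inner (\<psi> t) w < inner (\<psi> t) v"
  shows "\<exists>\<kappa>>0. \<forall>t\<in>{0..1}. \<forall>z\<in>B. \<forall>w\<in>C.
      \<exists>v\<in>K. inner (\<psi> t) z + \<kappa> \<le> inner (\<psi> t) v \<or> inner (\<psi> t) w + \<kappa> \<le> inner (\<psi> t) v"
proof (rule ccontr)
  assume contra: "\<not> ?thesis"
  have "\<exists>p. p \<in> {0..1} \<times> B \<times> C \<and> (\<forall>v\<in>K. inner (\<psi> (fst p)) v \<le> inner (\<psi> (fst p)) (fst (snd p)) + 1 / real (Suc n) \<and>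
     inner (\<psi> (fst p)) v \<le> inner (\<psi> (fst p)) (snd (snd p)) + 1 / real (Suc n))" for n
  proof -
    have "1 / real (Suc n) > 0" by simp
    then obtain t z w where "t \<in> {0..1}" "z \<in> B" "w \<in> C" and
      "\<forall>v\<in>K. \<not> (inner (\<psi> t) z + 1 / real (Suc n) \<le> inner (\<psi> t) v \<or> inner (\<psi> t) w + 1 / real (Suc n) \<le> inner (\<psi> t) v)"
      using contra by blast
    then show ?thesis by (intro exI[of _ "(t, z, w)"]) force
  qed
  then obtain p where p: "\<And>n. p n \<in> {0..1} \<times> B \<times> C" and
    pv: "\<And>n v. v \<in> K \<Longrightarrow> inner (\<psi> (fst (p n))) v \<le> inner (\<psi> (fst (p n))) (fst (snd (p n))) + 1 / real (Suc n) \<and>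
     inner (\<psi> (fst (p n))) v \<le> inner (\<psi> (fst (p n))) (snd (snd (p n))) + 1 / real (Suc n)"
    by metis
  have "compact ({0..1::real} \<times> B \<times> C)" using B C by (intro compact_Times compact_Icc)
  then obtain q s where q: "q \<in> {0..1} \<times> B \<times> C" and s: "strict_mono s" "(p \<circ> s) \<longlonglongrightarrow> q"
    using p unfolding compact_def by metis
  have lim: "(\<lambda>n. p (s n)) \<longlonglongrightarrow> q" using s(2) by (simp add: o_def)
  have inv: "(\<lambda>n. 1 / real (Suc (s n))) \<longlonglongrightarrow> 0"
    using LIMSEQ_subseq_LIMSEQ[OF LIMSEQ_Suc[OF lim_1_over_n] s(1)] by (simp add: o_def)
  have "inner (\<psi> (fst q)) v \<le> inner (\<psi> (fst q)) (fst (snd q)) + 0 \<and>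
      inner (\<psi> (fst q)) v \<le> inner (\<psi> (fst q)) (snd (snd q)) + 0" if "v \<in> K" for v
  proof
    show "inner (\<psi> (fst q)) v \<le> inner (\<psi> (fst q)) (fst (snd q)) + 0"
    proof (rule LIMSEQ_le)
      show "(\<lambda>n. inner (\<psi> (fst (p (s n)))) v) \<longlonglongrightarrow> inner (\<psi> (fst q)) v"
        unfolding \<psi>_def by (intro tendsto_intros lim)
      show "(\<lambda>n. inner (\<psi> (fst (p (s n)))) (fst (snd (p (s n)))) + 1 / real (Suc (s n))) \<longlonglongrightarrow>
          inner (\<psi> (fst q)) (fst (snd q)) + 0"
        unfolding \<psi>_def by (intro tendsto_intros lim inv)
    qed (use pv[OF that] in blast)
    show "inner (\<psi> (fst q)) v \<le> inner (\<psi> (fst q)) (snd (snd q)) + 0"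
    proof (rule LIMSEQ_le)
      show "(\<lambda>n. inner (\<psi> (fst (p (s n)))) v) \<longlonglongrightarrow> inner (\<psi> (fst q)) v"
        unfolding \<psi>_def by (intro tendsto_intros lim)
      show "(\<lambda>n. inner (\<psi> (fst (p (s n)))) (snd (snd (p (s n)))) + 1 / real (Suc (s n))) \<longlonglongrightarrow>
          inner (\<psi> (fst q)) (snd (snd q)) + 0"
        unfolding \<psi>_def by (intro tendsto_intros lim inv)
    qed (use pv[OF that] in blast)
  qed
  then show False
    using no[of "fst q" "fst (snd q)" "snd (snd q)"] q by fastforce
qed

text \<open>With \<open>z\<^sub>k\<close> maximizing \<open>\<psi> (k/n)\<close> over \<open>K\<close>, the strip at \<open>z\<^sub>k\<close> reaches to \<open>z\<^sub>k\<^sub>+\<^sub>1\<close>; maximality of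
\<open>z\<^sub>k\<^sub>+\<^sub>1\<close> for \<open>\<psi> ((k+1)/n)\<close> bounds its height by \<open>\<langle>c1 - c2, z\<^sub>k - z\<^sub>k\<^sub>+\<^sub>1\<rangle> / n\<close>, which telescopes.\<close>

lemma cover_quarter:
  fixes c1 c2 :: complex
  defines "\<psi> \<equiv> \<lambda>t. (1 - t) *\<^sub>R c1 + t *\<^sub>R c2"
  assumes K: "compact K" and BK: "B \<subseteq> K"
    and \<kappa>: "\<kappa> > 0" and gap: "\<forall>t\<in>{0..1}. \<forall>z\<in>B. \<forall>w\<in>C.
      \<exists>v\<in>K. inner (\<psi> t) z + \<kappa> \<le> inner (\<psi> t) v \<or> inner (\<psi> t) w + \<kappa> \<le> inner (\<psi> t) v"
    and e: "e > 0"
  shows "cover K C {z \<in> B. \<exists>t. 0 \<le> t \<and> t < 1 \<and> (\<forall>v\<in>K. inner (\<psi> t) v \<le> inner (\<psi> t) z)} e"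
proof (cases "K = {}")
  case True
  then have "B = {}" using BK by blast
  then show ?thesis using e by (simp add: cover_def) (intro exI[of _ "{}"], simp)
next
  case False
  obtain R where R: "\<And>z. z \<in> K \<Longrightarrow> norm z \<le> R" using compact_imp_bounded[OF K] bounded_iff by metis
  define L where "L = norm (c1 - c2) * (2 * R)"
  have L: "inner (c1 - c2) (z - z') \<le> L" if "z \<in> K" "z' \<in> K" for z z'
  proof -
    have "norm (z - z') \<le> 2 * R" using norm_triangle_ineq4[of z z'] R[OF that(1)] R[OF that(2)] by linarith
    then have "norm (c1 - c2) * norm (z - z') \<le> L" unfolding L_def by (intro mult_left_mono) auto
    then show ?thesis using norm_cauchy_schwarz[of "c1 - c2" "z - z'"] by linarith
  qed
  \<comment> \<open>The first bound makes every height smaller than \<open>\<kappa>\<close>; the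
    second keeps the sum of the heights, divided by \<open>\<kappa>\<close>, within
    \<open>e / 2\<close>.\<close>
  obtain N where N: "max (L / \<kappa>) (2 * L / (\<kappa> * e)) < real N" using reals_Archimedean2 by blast
  define n where "n = Suc N"
  have n: "real n > 0" by (simp add: n_def)
  have "L / \<kappa> < real n" "2 * L / (\<kappa> * e) < real n" using N by (auto simp: n_def)
  then have L_n: "L / real n < \<kappa>" "L / real n \<le> \<kappa> * e / 2"
    using n \<kappa> e by (simp_all add: field_simps)
  have "\<exists>z\<in>K. \<forall>v\<in>K. inner c v \<le> inner c z" for c
    by (rule continuous_attains_sup[OF K False, of "inner c"]) (intro continuous_intros)
  then have "\<forall>k. \<exists>z. z \<in> K \<and> (\<forall>v\<in>K. inner (\<psi> (real k / real n)) v \<le> inner (\<psi> (real k / real n)) z)"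
    by blast
  then obtain zs where "\<forall>k. zs k \<in> K \<and> (\<forall>v\<in>K. inner (\<psi> (real k / real n)) v \<le> inner (\<psi> (real k / real n)) (zs k))"
    by (rule choice[THEN exE])
  then have zs: "\<And>k. zs k \<in> K" "\<And>k v. v \<in> K \<Longrightarrow> inner (\<psi> (real k / real n)) v \<le> inner (\<psi> (real k / real n)) (zs k)"
    by blast+
  define \<eta> where "\<eta> k = inner (\<psi> (real k / real n)) (zs k - zs (Suc k))" for k
  have \<eta>0: "\<eta> k \<ge> 0" for k using zs(2)[OF zs(1)[of "Suc k"], of k] by (simp add: \<eta>_def inner_diff_right)
  \<comment> \<open>Consecutive directions differ by \<open>(c1 - c2) / n\<close>.\<close>
  have \<eta>_le: "\<eta> k \<le> inner (c1 - c2) (zs k - zs (Suc k)) / real n" for k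
  proof -
    have "inner (\<psi> (real k / real n)) v = inner (\<psi> (real (Suc k) / real n)) v + inner (c1 - c2) v / real n" for v
      by (simp add: \<psi>_def inner_add_left inner_diff_left algebra_simps add_divide_distrib diff_divide_distrib)
    moreover have "inner (\<psi> (real (Suc k) / real n)) (zs k - zs (Suc k)) \<le> 0"
      using zs(2)[OF zs(1)[of k], of "Suc k"] by (simp add: inner_diff_right)
    ultimately show ?thesis unfolding \<eta>_def by simp
  qed
  have sum_\<eta>: "(\<Sum>k<n. \<eta> k) \<le> L / real n"
  proof -
    have "(\<Sum>k<n. \<eta> k) \<le> (\<Sum>k<n. inner (c1 - c2) (zs k - zs (Suc k)) / real n)"
      by (intro sum_mono \<eta>_le)
    also have "\<dots> = inner (c1 - c2) (\<Sum>k<n. zs k - zs (Suc k)) / real n"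
      by (simp add: inner_sum_right sum_divide_distrib)
    also have "(\<Sum>k<n. zs k - zs (Suc k)) = zs 0 - zs n" by (rule sum_lessThan_telescope')
    also have "inner (c1 - c2) (zs 0 - zs n) / real n \<le> L / real n"
      using n by (intro divide_right_mono L zs) auto
    finally show ?thesis .
  qed
  have \<eta>_small: "\<eta> k < \<kappa>" if "k < n" for k
    using member_le_sum[of k "{..<n}" \<eta>] that \<eta>0 sum_\<eta> L_n by simp
  \<comment> \<open>Only those strips are kept whose function, divided by \<open>\<kappa>\<close>,
    is at least 1 on \<open>C\<close>.\<close>
  define J where "J = {k. k < n \<and> (\<forall>w\<in>C. \<kappa> \<le> inner (\<psi> (real k / real n)) (zs k) - inner (\<psi> (real k / real n)) w)}"
  have finJ: "finite J" by (simp add: J_def)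
  let ?c = "\<lambda>k. (- 1 / \<kappa>) *\<^sub>R \<psi> (real k / real n)"
  let ?r = "\<lambda>k. inner (\<psi> (real k / real n)) (zs k) / \<kappa>"
  have h: "inner (?c k) z + ?r k = (inner (\<psi> (real k / real n)) (zs k) - inner (\<psi> (real k / real n)) z) / \<kappa>" for k z
    by (simp add: diff_divide_distrib)
  \<comment> \<open>The supplement \<open>e / (2 * real n)\<close> makes the inequality in
    \<open>cover\<close> strict and costs \<open>e / 2\<close> in total.\<close>
  show ?thesis
  proof (rule coverI[OF finJ, where \<eta> = "\<lambda>k. \<eta> k / \<kappa> + e / (2 * real n)" and c = ?c and r = ?r], goal_cases)
    case (1 j)
    then show ?case using \<eta>0[of j] \<kappa> e by simp
  next
    case (2 j z)
    then show ?case unfolding h using zs(2)[of z j] \<kappa> by simp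
  next
    case (3 j z)
    then show ?case unfolding h using \<kappa> by (simp add: J_def)
  next
    case (4 z)
    then obtain t where zB: "z \<in> B" and t: "0 \<le> t" "t < 1" and max: "\<And>v. v \<in> K \<Longrightarrow> inner (\<psi> t) v \<le> inner (\<psi> t) z"
      by blast
    define k where "k = nat \<lfloor>t * real n\<rfloor>"
    have "0 \<le> t * real n" using t n by simp
    then have k1: "real k \<le> t * real n" "t * real n < real (Suc k)" unfolding k_def by linarith+
    have kn: "k < n"
    proof -
      have "t * real n < 1 * real n" using t n by (intro mult_strict_right_mono) auto
      then show ?thesis using k1 by simp
    qed
    define \<tau> where "\<tau> = real k / real n"
    define \<tau>' where "\<tau>' = real (Suc k) / real n"
    have \<tau>: "0 \<le> \<tau>" "\<tau> \<le> t" "t < \<tau>'" "\<tau> \<le> 1" using k1 n kn by (auto simp: \<tau>_def \<tau>'_def field_simps)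
    \<comment> \<open>An affine function of \<open>s\<close> that is nonnegative at \<open>t\<close>
      and nonpositive at the later \<open>\<tau>'\<close> cannot increase, so it is nonnegative at
      \<open>\<tau> \<le> t\<close>. Hence the strip at \<open>zs k\<close> that reaches
      \<open>zs (Suc k)\<close> contains \<open>z\<close>.\<close>
    define f where "f s = inner (\<psi> s) (z - zs (Suc k))" for s
    have f_affine: "f s = inner c1 (z - zs (Suc k)) - s * inner (c1 - c2) (z - zs (Suc k))" for s
      by (simp add: f_def \<psi>_def inner_add_left inner_diff_left algebra_simps)
    have "f t \<ge> 0" using max[OF zs(1)[of "Suc k"]] by (simp add: f_def inner_diff_right)
    moreover have "f \<tau>' \<le> 0" using zs(2)[of z "Suc k"] zB BK by (auto simp: f_def inner_diff_right \<tau>'_def)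
    ultimately have "(\<tau>' - t) * inner (c1 - c2) (z - zs (Suc k)) \<ge> 0" unfolding f_affine by (simp add: algebra_simps)
    then have "inner (c1 - c2) (z - zs (Suc k)) \<ge> 0" using \<tau> by (simp add: zero_le_mult_iff)
    then have "f \<tau> \<ge> f t" unfolding f_affine using \<tau> by (simp add: mult_right_mono)
    then have "f \<tau> \<ge> 0" using \<open>f t \<ge> 0\<close> by simp
    then have le: "inner (\<psi> \<tau>) (zs k) - inner (\<psi> \<tau>) z \<le> \<eta> k"
      by (simp add: f_def \<eta>_def \<tau>_def inner_diff_right)
    \<comment> \<open>Since \<open>z\<close> is within \<open>\<eta> k < \<kappa>\<close> of the
      maximum, the alternative for \<open>z\<close> in \<open>gap\<close> fails and the one for
      \<open>w\<close> remains.\<close>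
    have "\<kappa> \<le> inner (\<psi> \<tau>) (zs k) - inner (\<psi> \<tau>) w" if w: "w \<in> C" for w
    proof -
      have "\<tau> \<in> {0..1}" using \<tau> by simp
      then obtain v where v: "v \<in> K" "inner (\<psi> \<tau>) z + \<kappa> \<le> inner (\<psi> \<tau>) v \<or> inner (\<psi> \<tau>) w + \<kappa> \<le> inner (\<psi> \<tau>) v"
        using gap zB w by blast
      have "inner (\<psi> \<tau>) v \<le> inner (\<psi> \<tau>) (zs k)" using zs(2)[OF v(1)] by (simp add: \<tau>_def)
      then show ?thesis using v(2) le \<eta>_small[OF kn] by linarith
    qed
    then have "k \<in> J" using kn by (simp add: J_def \<tau>_def)
    moreover have "inner (?c k) z + ?r k < \<eta> k / \<kappa> + e / (2 * real n)"
    proof -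
      have "(inner (\<psi> \<tau>) (zs k) - inner (\<psi> \<tau>) z) / \<kappa> \<le> \<eta> k / \<kappa>"
        using le \<kappa> by (intro divide_right_mono) auto
      moreover have "e / (2 * real n) > 0" using e n by simp
      ultimately show ?thesis unfolding h \<tau>_def by linarith
    qed
    ultimately show ?case by blast
  next
    case 5
    have "(\<Sum>k\<in>J. \<eta> k / \<kappa> + e / (2 * real n)) \<le> (\<Sum>k<n. \<eta> k / \<kappa> + e / (2 * real n))"
      using \<eta>0 \<kappa> e by (intro sum_mono2) (auto simp: J_def)
    also have "\<dots> = (\<Sum>k<n. \<eta> k) / \<kappa> + e / 2"
      using n by (simp add: sum.distrib sum_divide_distrib)
    also have "(\<Sum>k<n. \<eta> k) / \<kappa> \<le> (\<kappa> * e / 2) / \<kappa>"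
      using order_trans[OF sum_\<eta> L_n(2)] \<kappa> by (intro divide_right_mono) auto
    also have "(\<kappa> * e / 2) / \<kappa> + e / 2 = e" using \<kappa> by simp
    finally show ?case by simp
  qed
qed

text \<open>The sides of the square with vertices 1, \<open>\<i>\<close>, -1 and
  \<open>-\<i>\<close>. Their linear parametrizations avoid 0 and meet every direction up to a
  positive factor, and linearity in the parameter is what makes the heights telescope.\<close>

definition quarters :: "(complex \<times> complex) set" where
  "quarters = {(1, \<i>), (\<i>, -1), (-1, -\<i>), (-\<i>, 1)}"

lemma quarters_nonzero:
  assumes "(c1, c2) \<in> quarters" "t \<in> {0..1}"
  shows "(1 - t) *\<^sub>R c1 + t *\<^sub>R c2 \<noteq> 0"
  using assms by (auto simp: quarters_def complex_eq_iff)

lemma direction_in_quarter: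
  assumes "c \<noteq> 0"
  shows "\<exists>(c1, c2)\<in>quarters. \<exists>t s. 0 \<le> t \<and> t < 1 \<and> s > 0 \<and> c = s *\<^sub>R ((1 - t) *\<^sub>R c1 + t *\<^sub>R c2)"
proof -
  have split: ?thesis if "(c1, c2) \<in> quarters" "p > 0" "q \<ge> 0" "c = p *\<^sub>R c1 + q *\<^sub>R c2" for c1 c2 p q
  proof -
    have "p + q > 0" using that by simp
    then have "(p + q) * (1 - q / (p + q)) = p" "(p + q) * (q / (p + q)) = q" "q / (p + q) < 1"
      using that by (simp_all add: field_simps)
    then have "c = (p + q) *\<^sub>R ((1 - q / (p + q)) *\<^sub>R c1 + (q / (p + q)) *\<^sub>R c2)"
      using that(4) by (simp only: scaleR_add_right scaleR_scaleR)
    then show ?thesis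
      using that \<open>p + q > 0\<close> \<open>q / (p + q) < 1\<close>
      by (intro bexI[of _ "(c1, c2)"])
        (unfold prod.case, intro exI[of _ "q / (p + q)"] exI[of _ "p + q"], simp)
  qed
  consider "Re c > 0" "Im c \<ge> 0" | "Re c \<le> 0" "Im c > 0" | "Re c < 0" "Im c \<le> 0" | "Re c \<ge> 0" "Im c < 0"
    using assms by (force simp: complex_eq_iff)
  then show ?thesis
  proof cases
    case 1
    then show ?thesis by (intro split[of 1 \<i> "Re c" "Im c"]) (auto simp: quarters_def complex_eq_iff)
  next
    case 2
    then show ?thesis by (intro split[of \<i> "-1" "Im c" "- Re c"]) (auto simp: quarters_def complex_eq_iff)
  next
    case 3
    then show ?thesis by (intro split[of "-1" "-\<i>" "- Re c" "- Im c"]) (auto simp: quarters_def complex_eq_iff)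
  next
    case 4
    then show ?thesis by (intro split[of "-\<i>" 1 "- Im c" "Re c"]) (auto simp: quarters_def complex_eq_iff)
  qed
qed

text \<open>Unless \<open>K\<close> is a single point, an extreme point lies outside of the relative
  interior, where a supporting hyperplane exists.\<close>

lemma extreme_point_supported:
  fixes z :: complex
  assumes K: "convex K" and z: "z extreme_point_of K"
  shows "\<exists>c. c \<noteq> 0 \<and> (\<forall>v\<in>K. inner c v \<le> inner c z)"
proof (cases "K = {z}")
  case True
  then show ?thesis by (intro exI[of _ 1]) simp
next
  case False
  have "z \<in> K" using z by (simp add: extreme_point_of_def)
  then obtain a where "a \<noteq> 0" "\<And>y. y \<in> K \<Longrightarrow> inner a z \<le> inner a y"
    using supporting_hyperplane_rel_boundary[OF K _ extreme_point_not_in_REL_INTERIOR[OF z False]] by metis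
  then show ?thesis by (intro exI[of _ "- a"]) simp
qed

text \<open>Neighbourhoods of the finitely many edge ends in \<open>L\<close> are covered by
  \<open>cover_edge_endpoint\<close>. The compact remainder shares no supporting line with the far
  slab, so \<open>uniform_support_gap\<close> and \<open>cover_quarter\<close> apply to each of the
  four quarters of directions.\<close>

lemma cover_slab:
  assumes K: "compact K" "convex K" and X: "compact X" "X \<subseteq> {z. z extreme_point_of K}"
    and ab: "a < b" and e: "e > 0"
  shows "cover K {z \<in> K. b \<le> Re z} {z \<in> X. Re z \<le> a} e"
proof -
  define C where "C = {z \<in> K. b \<le> Re z}"
  define L where "L = {z. z extreme_point_of K \<and> Re z \<le> a \<and> (\<exists>c w. c \<noteq> 0 \<and> w \<in> K \<and> b \<le> Re w \<and>
    (\<forall>v\<in>K. inner c v \<le> inner c z) \<and> inner c w = inner c z)}"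
  have finL: "finite L" unfolding L_def by (rule finite_edge_endpoints[OF K(2) ab])
  \<comment> \<open>Half of \<open>e\<close> is shared by the edge ends, the other half by the
    quarters at \<open>e / 8\<close> each; \<open>Suc\<close> avoids division by 0 when
    \<open>L\<close> is empty.\<close>
  define e1 where "e1 = e / (2 * real (Suc (card L)))"
  have e1: "e1 > 0" using e by (simp add: e1_def)
  have "\<exists>U. open U \<and> l \<in> U \<and> cover K C U e1" if l: "l \<in> L" for l
  proof -
    obtain c w where "l extreme_point_of K" "Re l \<le> a" "c \<noteq> 0" "w \<in> K" "b \<le> Re w"
      "\<forall>v\<in>K. inner c v \<le> inner c l" "inner c w = inner c l"
      using l unfolding L_def by blast
    then show ?thesis
      unfolding C_def using cover_edge_endpoint[OF K(1), of l c w b e1] ab e1 by auto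
  qed
  then obtain U where U: "\<And>l. l \<in> L \<Longrightarrow> open (U l)" "\<And>l. l \<in> L \<Longrightarrow> l \<in> U l" "\<And>l. l \<in> L \<Longrightarrow> cover K C (U l) e1"
    by metis
  have cov1: "cover K C (\<Union>l\<in>L. U l) (real (card L) * e1)" by (rule cover_UN[OF finL U(3)])
  define B where "B = {z \<in> X. Re z \<le> a} - (\<Union>l\<in>L. U l)"
  have XK: "X \<subseteq> K" using X by (auto simp: extreme_point_of_def)
  have cB: "compact B"
  proof -
    have "B = X \<inter> ({z. Re z \<le> a} \<inter> - (\<Union>l\<in>L. U l))" by (auto simp: B_def)
    moreover have "closed ({z. Re z \<le> a} \<inter> - (\<Union>l\<in>L. U l))"
      using U(1) by (intro closed_Int closed_halfspace_Re_le closed_Compl open_UN) auto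
    ultimately show ?thesis using X by (simp add: compact_Int_closed)
  qed
  have cC: "compact C"
  proof -
    have "C = K \<inter> {z. Re z \<ge> b}" by (auto simp: C_def)
    then show ?thesis using K closed_halfspace_Re_ge by (simp add: compact_Int_closed)
  qed
  have BK: "B \<subseteq> K" using XK by (auto simp: B_def)
  define Q where "Q = (\<lambda>(c1, c2). {z \<in> B. \<exists>t. 0 \<le> t \<and> t < 1 \<and>
    (\<forall>v\<in>K. inner ((1 - t) *\<^sub>R c1 + t *\<^sub>R c2) v \<le> inner ((1 - t) *\<^sub>R c1 + t *\<^sub>R c2) z)})"
  have "cover K C (Q (c1, c2)) (e / 8)" if q: "(c1, c2) \<in> quarters" for c1 c2
  proof -
    \<comment> \<open>If \<open>z\<close> and \<open>w\<close> both maximized, they would span an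
      edge and \<open>z\<close> would belong to \<open>L\<close>, whose neighbourhoods have been
      removed from \<open>B\<close>.\<close>
    have "\<exists>v\<in>K. inner ((1 - t) *\<^sub>R c1 + t *\<^sub>R c2) z < inner ((1 - t) *\<^sub>R c1 + t *\<^sub>R c2) v \<or>
        inner ((1 - t) *\<^sub>R c1 + t *\<^sub>R c2) w < inner ((1 - t) *\<^sub>R c1 + t *\<^sub>R c2) v"
      if t: "t \<in> {0..1}" and z: "z \<in> B" and w: "w \<in> C" for t z w
    proof (rule ccontr)
      let ?c = "(1 - t) *\<^sub>R c1 + t *\<^sub>R c2"
      assume "\<not> ?thesis"
      then have n: "\<forall>v\<in>K. inner ?c v \<le> inner ?c z" "\<forall>v\<in>K. inner ?c v \<le> inner ?c w" by (auto simp: not_less)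
      have "z \<in> K" "w \<in> K" using z BK w by (auto simp: C_def)
      then have "inner ?c w = inner ?c z" using n by (meson order_antisym)
      moreover have "z extreme_point_of K" "Re z \<le> a" using z X by (auto simp: B_def)
      ultimately have "z \<in> L"
        unfolding L_def using w n(1) quarters_nonzero[OF q t] by (auto simp: C_def)
      then show False using z U(2) by (auto simp: B_def)
    qed
    then obtain \<kappa> where "\<kappa> > 0" and "\<forall>t\<in>{0..1}. \<forall>z\<in>B. \<forall>w\<in>C.
      \<exists>v\<in>K. inner ((1 - t) *\<^sub>R c1 + t *\<^sub>R c2) z + \<kappa> \<le> inner ((1 - t) *\<^sub>R c1 + t *\<^sub>R c2) v \<or>
        inner ((1 - t) *\<^sub>R c1 + t *\<^sub>R c2) w + \<kappa> \<le> inner ((1 - t) *\<^sub>R c1 + t *\<^sub>R c2) v"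
      using uniform_support_gap[OF cB cC, of K c1 c2] by blast
    then show ?thesis unfolding Q_def prod.case using K(1) BK e by (intro cover_quarter) auto
  qed
  then have cov2: "cover K C (\<Union>q\<in>quarters. Q q) (real (card quarters) * (e / 8))"
    by (intro cover_UN) (auto simp: quarters_def)
  have card_q: "real (card quarters) * (e / 8) \<le> e / 2"
  proof -
    have "card quarters \<le> 4" unfolding quarters_def
      by (intro order_trans[OF card_insert_le_m1]) auto
    then have "real (card quarters) * (e / 8) \<le> 4 * (e / 8)" using e by (intro mult_right_mono) auto
    then show ?thesis by simp
  qed
  have card_L: "real (card L) * e1 \<le> e / 2"
  proof -
    have "real (card L) * e1 = (e / 2) * (real (card L) / real (Suc (card L)))" by (simp add: e1_def)
    also have "\<dots> \<le> (e / 2) * 1" using e by (intro mult_left_mono) auto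
    finally show ?thesis by simp
  qed
  have "z \<in> (\<Union>q\<in>quarters. Q q)" if z: "z \<in> B" for z
  proof -
    have "z extreme_point_of K" using z X by (auto simp: B_def)
    then obtain c where c: "c \<noteq> 0" "\<forall>v\<in>K. inner c v \<le> inner c z" using extreme_point_supported[OF K(2)] by blast
    then obtain c1 c2 t s where q: "(c1, c2) \<in> quarters" "0 \<le> t" "t < 1" "s > 0"
      "c = s *\<^sub>R ((1 - t) *\<^sub>R c1 + t *\<^sub>R c2)"
      using direction_in_quarter[OF c(1)] by blast
    have "\<forall>v\<in>K. inner ((1 - t) *\<^sub>R c1 + t *\<^sub>R c2) v \<le> inner ((1 - t) *\<^sub>R c1 + t *\<^sub>R c2) z"
      using c(2) q(4) unfolding q(5) inner_scaleR_left by (simp only: mult_le_cancel_left_pos)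
    then have "z \<in> Q (c1, c2)" unfolding Q_def using z q by blast
    then show ?thesis using q(1) by blast
  qed
  then have "{z \<in> X. Re z \<le> a} \<subseteq> (\<Union>l\<in>L. U l) \<union> (\<Union>q\<in>quarters. Q q)" by (auto simp: B_def)
  then have "cover K C {z \<in> X. Re z \<le> a} (real (card L) * e1 + real (card quarters) * (e / 8))"
    using cover_mono[OF cover_Un[OF cov1 cov2]] by blast
  then show ?thesis
    unfolding C_def[symmetric] by (rule cover_le) (use card_L card_q in linarith)
qed

text \<open>Affine functions pull back along multiplication by \<open>w\<close>, whose real adjoint
  is multiplication by \<open>cnj w\<close>.\<close>

lemma cover_image:
  assumes "cover ((\<lambda>z. w * z) ` K) ((\<lambda>z. w * z) ` C) ((\<lambda>z. w * z) ` B) e"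
  shows "cover K C B e"
proof -
  have rot: "inner c (w * z) = inner (cnj w * c) z" for c z
    by (simp add: inner_complex_def algebra_simps)
  obtain I :: "(complex \<times> real \<times> real) set" where I: "finite I"
    "\<forall>(c, r, \<eta>)\<in>I. 0 \<le> \<eta> \<and> (\<forall>z\<in>(\<lambda>z. w * z) ` K. 0 \<le> inner c z + r) \<and>
      (\<forall>z\<in>(\<lambda>z. w * z) ` C. 1 \<le> inner c z + r)"
    "\<forall>z\<in>(\<lambda>z. w * z) ` B. \<exists>(c, r, \<eta>)\<in>I. inner c z + r < \<eta>" "(\<Sum>(c, r, \<eta>)\<in>I. \<eta>) \<le> e"
    using assms unfolding cover_def by blast
  show ?thesis
  proof (rule coverI[OF I(1), where c = "\<lambda>(c, r, \<eta>). cnj w * c" and r = "\<lambda>(c, r, \<eta>). r" and \<eta> = "\<lambda>(c, r, \<eta>). \<eta>"], goal_cases)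
    case (4 z)
    then have "w * z \<in> (\<lambda>z. w * z) ` B" by blast
    then obtain i where "i \<in> I" "case i of (c, r, \<eta>) \<Rightarrow> inner c (w * z) + r < \<eta>" using I(3) by blast
    then show ?case by (intro bexI[of _ i]) (auto simp: rot split: prod.splits)
  qed (use I in \<open>auto simp: rot\<close>)
qed

lemma cover_slab_rotated:
  assumes K: "compact K" "convex K" and X: "compact X" "X \<subseteq> {z. z extreme_point_of K}"
    and w: "w \<noteq> 0" and ab: "a < b" and e: "e > 0"
  shows "cover K {z \<in> K. b \<le> Re (w * z)} {z \<in> X. Re (w * z) \<le> a} e"
proof (rule cover_image)
  let ?f = "\<lambda>z. w * z"
  have lin: "linear ?f" and inj: "inj ?f" using w by (auto simp: inj_on_def)
  have "?f ` X \<subseteq> {z. z extreme_point_of ?f ` K}"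
    using X open_segment_linear_image[OF lin inj] w by (auto simp: extreme_point_of_def)
  moreover have "compact (?f ` K)" "compact (?f ` X)"
    using K X by (auto intro!: compact_continuous_image continuous_intros)
  moreover have "convex (?f ` K)" using K by (intro convex_linear_image lin)
  ultimately have "cover (?f ` K) {z \<in> ?f ` K. b \<le> Re z} {z \<in> ?f ` X. Re z \<le> a} e"
    using ab e by (intro cover_slab)
  moreover have "{z \<in> ?f ` K. b \<le> Re z} = ?f ` {z \<in> K. b \<le> Re (w * z)}"
    "{z \<in> ?f ` X. Re z \<le> a} = ?f ` {z \<in> X. Re (w * z) \<le> a}" by auto
  ultimately show "cover (?f ` K) (?f ` {z \<in> K. b \<le> Re (w * z)}) (?f ` {z \<in> X. Re (w * z) \<le> a}) e"
    by simp
qed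

text \<open>A partition of \<open>\<psi>\<close> rather than of 1, subordinate to the strips; it
  replaces the splitting of a spectral subspace along a cover.\<close>

lemma subordinate_partition:
  fixes h :: "'i \<Rightarrow> 'b :: metric_space \<Rightarrow> real" and \<psi> :: "'b \<Rightarrow> real"
  assumes I: "finite I" and B: "compact B" and h: "\<And>i. continuous_on UNIV (h i)"
    and cov: "\<And>z. z \<in> B \<Longrightarrow> \<exists>i\<in>I. h i z < \<eta> i"
    and \<psi>: "continuous_on UNIV \<psi>" "\<And>z. 0 \<le> \<psi> z"
  obtains g where "\<And>i. continuous_on UNIV (g i)" "\<And>i z. 0 \<le> g i z" "\<And>i z. g i z \<noteq> 0 \<Longrightarrow> h i z < \<eta> i"
    "\<And>z. z \<in> B \<or> \<psi> z = 0 \<Longrightarrow> (\<Sum>i\<in>I. g i z) = \<psi> z"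
proof -
  define t where "t i z = max 0 (\<eta> i - h i z)" for i z
  define G where "G z = (\<Sum>i\<in>I. t i z)" for z
  have ct: "continuous_on UNIV (t i)" for i unfolding t_def by (intro continuous_intros h)
  then have cG: "continuous_on UNIV G" unfolding G_def by (intro continuous_intros)
  have Gpos: "G z > 0" if "z \<in> B" for z
  proof -
    obtain i where "i \<in> I" "h i z < \<eta> i" using cov \<open>z \<in> B\<close> by blast
    then show ?thesis unfolding G_def using I by (intro sum_pos2[of I i]) (auto simp: t_def)
  qed
  have "\<exists>m>0. \<forall>z\<in>B. m \<le> G z"
  proof (cases "B = {}")
    case True
    then show ?thesis by (intro exI[of _ 1]) simp
  next
    case False
    then obtain z0 where "z0 \<in> B" "\<forall>z\<in>B. G z0 \<le> G z"
      using continuous_attains_inf[OF B False continuous_on_subset[OF cG]] by blast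
    then show ?thesis using Gpos by (intro exI[of _ "G z0"]) auto
  qed
  then obtain m where m: "m > 0" "\<And>z. z \<in> B \<Longrightarrow> m \<le> G z" by blast
  \<comment> \<open>Clipping the denominator at the minimum \<open>m\<close> of \<open>G\<close> on
    \<open>B\<close> keeps \<open>g i\<close> continuous everywhere without changing it on
    \<open>B\<close>.\<close>
  define g where "g i z = \<psi> z * t i z / max m (G z)" for i z
  have mG: "max m (G z) > 0" for z using m(1) by (simp add: less_max_iff_disj)
  show thesis
  proof
    show "continuous_on UNIV (g i)" for i
      unfolding g_def using mG by (intro continuous_intros \<psi> ct cG) (metis less_irrefl)
    show "0 \<le> g i z" for i z
      unfolding g_def using \<psi>(2)[of z] mG[of z] by (intro divide_nonneg_pos mult_nonneg_nonneg) (auto simp: t_def)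
    show "h i z < \<eta> i" if "g i z \<noteq> 0" for i z
      using that by (auto simp: g_def t_def max_def split: if_splits)
    show "(\<Sum>i\<in>I. g i z) = \<psi> z" if "z \<in> B \<or> \<psi> z = 0" for z
    proof -
      have "(\<Sum>i\<in>I. g i z) = \<psi> z * G z / max m (G z)"
        by (simp add: g_def G_def sum_distrib_left sum_divide_distrib)
      moreover have "max m (G z) = G z" if "z \<in> B" using m(2)[OF that] by simp
      ultimately show ?thesis using that mG[of z] by (metis div_0 less_irrefl mult_zero_left nonzero_mult_div_cancel_right)
    qed
  qed
qed

section \<open>From weak to strong convergence\<close>

text \<open>Convergence is along a filter because topologies are to be compared and sequences need
  not determine them. Symmetry and the location of the spectrum hold only eventually, as along a
  neighbourhood filter.\<close>

locale weakly_convergent_pairs =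
  fixes F :: "'i filter" and A B :: "'i \<Rightarrow> 'a :: complex_hilbert_space \<Rightarrow>\<^sub>L 'a"
    and A0 B0 :: "'a \<Rightarrow>\<^sub>L 'a" and K :: "complex set"
  assumes pair: "eventually (\<lambda>j. sym_pair (A j) (B j) \<and> jspec (A j) (B j) \<subseteq> K) F"
    and pair0: "sym_pair A0 B0"
    and limA: "((\<lambda>j. ip (A j x) y) \<longlongrightarrow> ip (A0 x) y) F"
    and limB: "((\<lambda>j. ip (B j x) y) \<longlongrightarrow> ip (B0 x) y) F"
begin

lemma limit_affine:
  "((\<lambda>j. ip ((Re c *\<^sub>R A j + Im c *\<^sub>R B j + r *\<^sub>R id_blinfun) x) y) \<longlongrightarrow>
    ip ((Re c *\<^sub>R A0 + Im c *\<^sub>R B0 + r *\<^sub>R id_blinfun) x) y) F"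
  by (simp add: blinfun.bilinear_simps ip_simps) (intro tendsto_intros limA limB)

text \<open>The continuous functions \<open>\<psi>\<close> and \<open>k\<close> play the roles of
  the spectral projections of the limit over \<open>D\<close> and of the approximating pairs over
  \<open>C\<close>. The conclusion says that mass of the limit in \<open>D\<close> does not move
  into \<open>C\<close>.\<close>

lemma separation:
  assumes D: "compact D" and cov: "\<And>e. e > 0 \<Longrightarrow> cover K C D e"
    and \<psi>: "continuous_on UNIV \<psi>" "\<And>z. 0 \<le> \<psi> z" "\<And>z. \<psi> z \<le> 1"
      "\<And>z. z \<in> jspec A0 B0 \<Longrightarrow> \<psi> z \<noteq> 0 \<Longrightarrow> z \<in> D"
    and k: "\<And>z. 0 \<le> k z" "\<And>z. k z \<le> 1" "\<And>z. z \<in> K \<Longrightarrow> k z \<noteq> 0 \<Longrightarrow> z \<in> C"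
    and P: "eventually (\<lambda>j. is_fun (A j) (B j) k (P j)) F"
    and \<Psi>: "is_fun A0 B0 \<psi> \<Psi>"
  shows "((\<lambda>j. P j (\<Psi> x)) \<longlongrightarrow> 0) F"
proof (rule tendstoI)
  fix e :: real assume e: "e > 0"
  \<comment> \<open>A cover of total height \<open>q\<^sup>2\<close> gives the final bound
    \<open>q * norm x < e\<close> by Cauchy--Schwarz.\<close>
  define q where "q = e / (norm x + 1)"
  have nx: "norm x + 1 > 0" by (simp add: add_nonneg_pos)
  have q: "q > 0" "q * norm x < e" using e nx by (auto simp: q_def field_simps)
  obtain I :: "(complex \<times> real \<times> real) set" where I: "finite I"
    "\<forall>(c, r, \<eta>)\<in>I. 0 \<le> \<eta> \<and> (\<forall>z\<in>K. 0 \<le> inner c z + r) \<and> (\<forall>z\<in>C. 1 \<le> inner c z + r)"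
    "\<forall>z\<in>D. \<exists>(c, r, \<eta>)\<in>I. inner c z + r < \<eta>" "(\<Sum>(c, r, \<eta>)\<in>I. \<eta>) \<le> q\<^sup>2"
    using cov[of "q\<^sup>2"] q unfolding cover_def by auto
  define h where "h i z = inner (fst i) z + fst (snd i)" for i :: "complex \<times> real \<times> real" and z
  define \<eta> where "\<eta> i = snd (snd i)" for i :: "complex \<times> real \<times> real"
  have \<eta>0: "0 \<le> \<eta> i" and hK: "\<And>z. z \<in> K \<Longrightarrow> 0 \<le> h i z" and hC: "\<And>z. z \<in> C \<Longrightarrow> 1 \<le> h i z" if "i \<in> I" for i
    using bspec[OF I(2) that] by (auto simp: h_def \<eta>_def split_beta)
  have sum_\<eta>: "(\<Sum>i\<in>I. \<eta> i) \<le> q\<^sup>2" using I(4) by (simp add: \<eta>_def split_beta)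
  have hD: "\<exists>i\<in>I. h i z < \<eta> i" if "z \<in> D" for z
    using bspec[OF I(3) that] by (simp add: h_def \<eta>_def split_beta)
  have ch: "continuous_on UNIV (h i)" for i unfolding h_def by (intro continuous_intros)
  obtain g where g: "\<And>i. continuous_on UNIV (g i)" "\<And>i z. 0 \<le> g i z" "\<And>i z. g i z \<noteq> 0 \<Longrightarrow> h i z < \<eta> i"
    and g_sum: "\<And>z. z \<in> D \<or> \<psi> z = 0 \<Longrightarrow> (\<Sum>i\<in>I. g i z) = \<psi> z"
    using subordinate_partition[OF I(1) D ch hD \<psi>(1,2)] by metis
  \<comment> \<open>On the joint spectrum, \<open>\<psi>\<close> vanishes outside of
    \<open>D\<close>, so one of the two cases of \<open>g_sum\<close> always applies.\<close>
  have gsum: "(\<Sum>i\<in>I. g i z) = \<psi> z" if "z \<in> jspec A0 B0" for z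
    using g_sum \<psi>(4)[OF that] by blast
  have "\<exists>S. is_fun A0 B0 (g i) S" for i
    by (intro is_fun_exists[OF pair0] continuous_on_subset[OF g(1)]) simp
  then obtain \<Gamma> where \<Gamma>: "\<And>i. is_fun A0 B0 (g i) (\<Gamma> i)" by metis
  have \<Psi>_sum: "\<Psi> = (\<Sum>i\<in>I. \<Gamma> i)"
    by (rule is_fun_unique[OF pair0 \<Psi>]) (rule is_fun_cong[OF is_fun_sum[OF pair0 \<Gamma>] gsum])
  define y where "y i = \<Gamma> i x" for i
  \<comment> \<open>In place of orthogonality: the \<open>g i\<close> are nonnegative with sum at
    most 1, hence so is the sum of their squares.\<close>
  have sum_y: "(\<Sum>i\<in>I. (norm (y i))\<^sup>2) \<le> (norm x)\<^sup>2"
  proof -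
    have "(\<Sum>i\<in>I. (norm (y i))\<^sup>2) = ip ((\<Sum>i\<in>I. \<Gamma> i o\<^sub>L \<Gamma> i) x) x"
    proof -
      have "(\<Sum>i\<in>I. (norm (y i))\<^sup>2) = (\<Sum>i\<in>I. ip ((\<Gamma> i o\<^sub>L \<Gamma> i) x) x)"
        by (intro sum.cong) (simp_all only: y_def is_fun_norm_sq[OF \<Gamma>])
      also have "\<dots> = ip (\<Sum>i\<in>I. (\<Gamma> i o\<^sub>L \<Gamma> i) x) x"
        by (rule bounded_bilinear.sum_left[OF bounded_bilinear_ip, symmetric])
      finally show ?thesis by (simp add: blinfun.sum_left)
    qed
    also have "\<dots> \<le> ip ((1 *\<^sub>R id_blinfun) x) x"
    proof (rule is_fun_mono[OF pair0 is_fun_sum[OF pair0 is_fun_mult[OF pair0 \<Gamma> \<Gamma>]] is_fun_const])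
      fix z assume z: "z \<in> jspec A0 B0"
      have "g i z * g i z \<le> g i z" if "i \<in> I" for i
      proof -
        have "g i z \<le> (\<Sum>i\<in>I. g i z)" using that I(1) g(2) by (intro member_le_sum) auto
        then have "g i z \<le> 1" using gsum[OF z] \<psi>(3)[of z] by simp
        then show ?thesis using g(2)[of i z] by (simp add: mult_left_le)
      qed
      then have "(\<Sum>i\<in>I. g i z * g i z) \<le> (\<Sum>i\<in>I. g i z)" by (rule sum_mono)
      then show "(\<Sum>i\<in>I. g i z * g i z) \<le> 1" using gsum[OF z] \<psi>(3)[of z] by simp
    qed
    finally show ?thesis by (simp add: cinner_self)
  qed
  define H where "H j i = Re (fst i) *\<^sub>R A j + Im (fst i) *\<^sub>R B j + fst (snd i) *\<^sub>R id_blinfun"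
    for j and i :: "complex \<times> real \<times> real"
  define H0 where "H0 i = Re (fst i) *\<^sub>R A0 + Im (fst i) *\<^sub>R B0 + fst (snd i) *\<^sub>R id_blinfun"
    for i :: "complex \<times> real \<times> real"
  have H0: "is_fun A0 B0 (h i) (H0 i)" for i
    unfolding h_def H0_def by (rule is_fun_affine[OF pair0])
  \<comment> \<open>The support of \<open>g i\<close> lies in the strip where
    \<open>h i < \<eta> i\<close>.\<close>
  have H0_le: "ip (H0 i (y i)) (y i) \<le> \<eta> i * (norm (y i))\<^sup>2" for i
  proof -
    have "ip ((\<Gamma> i o\<^sub>L (H0 i o\<^sub>L \<Gamma> i)) x) x \<le> ip ((\<eta> i *\<^sub>R (\<Gamma> i o\<^sub>L \<Gamma> i)) x) x"
    proof (rule is_fun_mono[OF pair0 is_fun_mult[OF pair0 \<Gamma> is_fun_mult[OF pair0 H0 \<Gamma>]]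
          is_fun_cmult[OF pair0 is_fun_mult[OF pair0 \<Gamma> \<Gamma>]]])
      fix z
      show "g i z * (h i z * g i z) \<le> \<eta> i * (g i z * g i z)"
      proof (cases "g i z = 0")
        case False
        then have "h i z * (g i z * g i z) \<le> \<eta> i * (g i z * g i z)"
          using g(3)[of i z] by (intro mult_right_mono) auto
        then show ?thesis by (simp add: mult_ac)
      qed simp
    qed
    then show ?thesis
      using is_fun_ip[OF \<Gamma>] is_fun_norm_sq[OF \<Gamma>, of i x] by (simp add: y_def blinfun.scaleR_left ip_simps)
  qed
  have "(\<Sum>i\<in>I. sqrt (ip (H0 i (y i)) (y i))) < e"
  proof -
    have "(\<Sum>i\<in>I. sqrt (ip (H0 i (y i)) (y i))) \<le> (\<Sum>i\<in>I. sqrt (\<eta> i) * norm (y i))"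
    proof (rule sum_mono)
      fix i assume "i \<in> I"
      have "sqrt (ip (H0 i (y i)) (y i)) \<le> sqrt (\<eta> i * (norm (y i))\<^sup>2)" using H0_le by (rule real_sqrt_le_mono)
      then show "sqrt (ip (H0 i (y i)) (y i)) \<le> sqrt (\<eta> i) * norm (y i)" by (simp add: real_sqrt_mult)
    qed
    also have "\<dots> \<le> q * norm x"
    proof (rule power2_le_imp_le)
      have "(\<Sum>i\<in>I. sqrt (\<eta> i) * norm (y i))\<^sup>2 \<le> (\<Sum>i\<in>I. (sqrt (\<eta> i))\<^sup>2) * (\<Sum>i\<in>I. (norm (y i))\<^sup>2)"
        by (rule Cauchy_Schwarz_ineq_sum)
      also have "(\<Sum>i\<in>I. (sqrt (\<eta> i))\<^sup>2) = (\<Sum>i\<in>I. \<eta> i)" using \<eta>0 by (intro sum.cong) auto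
      also have "(\<Sum>i\<in>I. \<eta> i) * (\<Sum>i\<in>I. (norm (y i))\<^sup>2) \<le> q\<^sup>2 * (norm x)\<^sup>2"
        using sum_\<eta> sum_y by (intro mult_mono) (auto intro: sum_nonneg)
      finally show "(\<Sum>i\<in>I. sqrt (\<eta> i) * norm (y i))\<^sup>2 \<le> (q * norm x)\<^sup>2" by (simp add: power_mult_distrib)
      show "0 \<le> q * norm x" using q by simp
    qed
    finally show ?thesis using q(2) by simp
  qed
  \<comment> \<open>The finitely many vectors \<open>y i\<close> come from the limit and do not
    depend on \<open>j\<close>, so weak convergence suffices.\<close>
  moreover have "((\<lambda>j. \<Sum>i\<in>I. sqrt (ip (H j i (y i)) (y i))) \<longlongrightarrow> (\<Sum>i\<in>I. sqrt (ip (H0 i (y i)) (y i)))) F"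
    unfolding H_def H0_def by (intro tendsto_sum tendsto_real_sqrt limit_affine)
  ultimately have "eventually (\<lambda>j. (\<Sum>i\<in>I. sqrt (ip (H j i (y i)) (y i))) < e) F"
    by (intro order_tendstoD(2))
  then show "eventually (\<lambda>j. dist (P j (\<Psi> x)) 0 < e) F"
    using pair P
  proof eventually_elim
    case (elim j)
    then have AB: "sym_pair (A j) (B j)" and sub: "jspec (A j) (B j) \<subseteq> K" and Pj: "is_fun (A j) (B j) k (P j)" by auto
    have "norm (P j (y i)) \<le> sqrt (ip (H j i (y i)) (y i))" if i: "i \<in> I" for i
    proof (rule real_le_rsqrt)
      have H: "is_fun (A j) (B j) (h i) (H j i)"
        unfolding h_def H_def by (rule is_fun_affine[OF AB])
      \<comment> \<open>On \<open>K\<close> the affine function dominates \<open>k\<^sup>2\<close>: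
        it is at least 1 where \<open>k\<close> does not vanish and nonnegative elsewhere.\<close>
      have "ip ((P j o\<^sub>L P j) (y i)) (y i) \<le> ip (H j i (y i)) (y i)"
      proof (rule is_fun_mono[OF AB is_fun_mult[OF AB Pj Pj] H])
        fix z assume "z \<in> jspec (A j) (B j)"
        then have z: "z \<in> K" using sub by blast
        show "k z * k z \<le> h i z"
        proof (cases "k z = 0")
          case True
          then show ?thesis using hK[OF i z] by simp
        next
          case False
          have "k z * k z \<le> 1" using k(1,2)[of z] by (simp add: mult_le_one)
          then show ?thesis using hC[OF i k(3)[OF z False]] by simp
        qed
      qed
      then show "(norm (P j (y i)))\<^sup>2 \<le> ip (H j i (y i)) (y i)" by (simp only: is_fun_norm_sq[OF Pj])
    qed
    then have "(\<Sum>i\<in>I. norm (P j (y i))) \<le> (\<Sum>i\<in>I. sqrt (ip (H j i (y i)) (y i)))" by (rule sum_mono)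
    moreover have "norm (P j (\<Psi> x)) \<le> (\<Sum>i\<in>I. norm (P j (y i)))"
      by (simp add: \<Psi>_sum y_def blinfun.sum_left blinfun.sum_right norm_sum)
    ultimately show ?case using elim by simp
  qed
qed

end

section \<open>Piecewise linear interpolation of the square\<close>

definition clamp01 :: "real \<Rightarrow> real" where
  "clamp01 y = max 0 (min 1 y)"

lemma clamp01_bounds: "0 \<le> clamp01 y" "clamp01 y \<le> 1"
  by (auto simp: clamp01_def)

text \<open>The sum below interpolates \<open>x\<^sup>2\<close> linearly between the integers up to \<open>N\<close>.\<close>

lemma sum_clamp01_ge_top:
  "real N \<le> x \<Longrightarrow> (\<Sum>m<N. (2 * real m + 1) * clamp01 (x - real m)) = (real N)\<^sup>2"
proof (induction N)
  case (Suc N)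
  then have "clamp01 (x - real N) = 1" by (simp add: clamp01_def)
  then show ?case using Suc by (simp add: power2_eq_square algebra_simps)
qed simp

text \<open>A convex function lies below its chords.\<close>

lemma square_le_sum_clamp01:
  assumes "0 \<le> x" "x \<le> real N"
  shows "x\<^sup>2 \<le> (\<Sum>m<N. (2 * real m + 1) * clamp01 (x - real m))"
  using assms
proof (induction N)
  case (Suc N)
  show ?case
  proof (cases "x \<le> real N")
    case True
    have "0 \<le> (2 * real N + 1) * clamp01 (x - real N)" using clamp01_bounds by simp
    then show ?thesis using Suc True by simp
  next
    case False
    define y where "y = x - real N"
    have y: "0 \<le> y" "y \<le> 1" using False Suc by (auto simp: y_def)
    then have c: "clamp01 y = y" by (simp add: clamp01_def)
    have "x\<^sup>2 = (real N)\<^sup>2 + 2 * real N * y + y * y" by (simp add: y_def power2_eq_square algebra_simps)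
    also have "\<dots> \<le> (real N)\<^sup>2 + (2 * real N + 1) * y"
      using mult_left_le[of y y] y by (simp add: algebra_simps)
    also have "\<dots> = (\<Sum>m<Suc N. (2 * real m + 1) * clamp01 (x - real m))"
      using sum_clamp01_ge_top[of N x] False c by (simp add: y_def)
    finally show ?thesis .
  qed
qed simp

text \<open>Completing the last partial layer gives the square of an integer that is at most
  \<open>x + 1\<close>.\<close>

lemma sum_clamp01_le_square:
  assumes "0 \<le> x"
  shows "(\<Sum>m<N. (2 * real m + 1) * clamp01 (x - real m)) \<le> (x + 1)\<^sup>2"
proof (induction N)
  case (Suc N)
  show ?case
  proof (cases "x \<le> real N")
    case True
    then have "clamp01 (x - real N) = 0" by (simp add: clamp01_def)
    then show ?thesis using Suc by simp
  next
    case False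
    have "(\<Sum>m<Suc N. (2 * real m + 1) * clamp01 (x - real m)) = (real N)\<^sup>2 + (2 * real N + 1) * clamp01 (x - real N)"
      using sum_clamp01_ge_top[of N x] False by simp
    also have "\<dots> \<le> (real N)\<^sup>2 + (2 * real N + 1) * 1"
      using clamp01_bounds by (intro add_left_mono mult_left_mono) auto
    also have "\<dots> = (real N + 1)\<^sup>2" by (simp add: power2_eq_square algebra_simps)
    also have "\<dots> \<le> (x + 1)\<^sup>2" using False by (intro power_mono) auto
    finally show ?thesis .
  qed
qed simp

section \<open>Semicontinuity of norms and strong convergence\<close>

context weakly_convergent_pairs
begin

text \<open>The upper thresholds \<open>\<theta>\<close> are applied to the approximating pairs, the thresholds \<open>\<rho>\<close>, lower by
\<open>2 d\<close>, to the limit, so that the supports of \<open>\<theta> m\<close> and \<open>1 - \<rho> m\<close> have distance \<open>d\<close>.\<close>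

lemma eventually_square_le:
  assumes K: "compact K" "convex K" and ex: "jspec A0 B0 \<subseteq> {z. z extreme_point_of K}"
    and c: "c \<noteq> 0" and M: "\<And>z. z \<in> K \<Longrightarrow> \<bar>inner c z\<bar> \<le> M" and \<delta>: "\<delta> > 0"
  shows "eventually (\<lambda>j. (norm ((Re c *\<^sub>R A j + Im c *\<^sub>R B j + M *\<^sub>R id_blinfun) x))\<^sup>2
    \<le> (norm ((Re c *\<^sub>R A0 + Im c *\<^sub>R B0 + M *\<^sub>R id_blinfun) x))\<^sup>2 + \<delta>) F"
proof -
  define s where "s z = inner c z + M" for z
  define S where "S j = Re c *\<^sub>R A j + Im c *\<^sub>R B j + M *\<^sub>R id_blinfun" for j
  define S0 where "S0 = Re c *\<^sub>R A0 + Im c *\<^sub>R B0 + M *\<^sub>R id_blinfun"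
  have S0: "is_fun A0 B0 s S0" unfolding S0_def s_def by (rule is_fun_affine[OF pair0])
  have sK: "0 \<le> s z" "s z \<le> 2 * M" if "z \<in> K" for z using M[OF that] by (auto simp: s_def)
  have XK: "jspec A0 B0 \<subseteq> K" using ex by (auto simp: extreme_point_of_def)
  have cs: "continuous_on UNIV s" unfolding s_def by (intro continuous_intros)
  \<comment> \<open>The layers below enlarge the square of \<open>s\<close> by at most
    \<open>6 * d * s z + 9 * d\<^sup>2\<close>; with \<open>d \<le> 1\<close> the form of this error
    at \<open>x\<close> is at most \<open>d * a\<close>, hence at most
    \<open>\<delta> / 2\<close>.\<close>
  define a where "a = 6 * \<bar>ip (S0 x) x\<bar> + 9 * (norm x)\<^sup>2 + 1"
  have a: "a > 0" by (simp add: a_def add_nonneg_pos)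
  define d where "d = min 1 (\<delta> / (2 * a))"
  have d: "0 < d" "d \<le> 1" "d * a \<le> \<delta> / 2"
    using a \<delta> by (auto simp: d_def min_def field_simps)
  \<comment> \<open>\<open>N\<close> layers of width \<open>d\<close> exhaust the range of
    \<open>s\<close> on \<open>K\<close>.\<close>
  obtain N where N: "2 * M / d < real N" using reals_Archimedean2 by blast
  define \<theta> where "\<theta> m z = clamp01 (s z / d - real m)" for m z
  define \<rho> where "\<rho> m z = clamp01 (s z / d + 2 - real m)" for m z
  have c\<theta>: "continuous_on UNIV (\<theta> m)" for m
    unfolding \<theta>_def clamp01_def by (intro continuous_intros cs) (use d in auto)
  have c\<rho>: "continuous_on UNIV (\<rho> m)" for m
    unfolding \<rho>_def clamp01_def by (intro continuous_intros cs) (use d in auto)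
  \<comment> \<open>The choice is meaningful only where the pair is symmetric, which holds
    eventually.\<close>
  define P where "P m j = (SOME S. is_fun (A j) (B j) (\<theta> m) S)" for m j
  have P: "is_fun (A j) (B j) (\<theta> m) (P m j)" if "sym_pair (A j) (B j)" for m j
  proof -
    have "\<exists>S. is_fun (A j) (B j) (\<theta> m) S"
      by (rule is_fun_exists[OF that continuous_on_subset[OF c\<theta>]]) simp
    then show ?thesis unfolding P_def by (rule someI_ex)
  qed
  have evP: "eventually (\<lambda>j. is_fun (A j) (B j) (\<theta> m) (P m j)) F" for m
    using pair by eventually_elim (use P in blast)
  have "\<exists>Q. is_fun A0 B0 (\<rho> m) Q" for m
    by (rule is_fun_exists[OF pair0 continuous_on_subset[OF c\<rho>]]) simp
  then obtain Q where Q: "\<And>m. is_fun A0 B0 (\<rho> m) (Q m)" by metis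
  have threshold: "eventually (\<lambda>j. ip (P m j x) x \<le> ip (Q m x) x + \<epsilon>) F" if \<epsilon>: "\<epsilon> > 0" for m \<epsilon>
  proof -
    define v where "v = (1 *\<^sub>R id_blinfun - Q m) x"
    have xv: "x = Q m x + v" by (simp add: v_def blinfun.bilinear_simps)
    have Re_c: "inner c z = Re (cnj c * z)" for z by (simp add: inner_complex_def)
    have "((\<lambda>j. P m j v) \<longlongrightarrow> 0) F"
      unfolding v_def
    proof (rule separation[OF _ _ _ _ _ _ _ _ _ evP[of m] is_fun_diff[OF pair0 is_fun_const Q]])
      \<comment> \<open>\<open>\<theta> m\<close> lives where \<open>s z > m * d\<close> and
        \<open>1 - \<rho> m\<close> where \<open>s z < (m - 1) * d\<close>; multiplication by
        \<open>cnj c\<close> turns both conditions into half-planes for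
        \<open>cover_slab_rotated\<close>.\<close>
      let ?D = "{z \<in> jspec A0 B0. Re (cnj c * z) \<le> (real m - 1) * d - M}"
      let ?C = "{z \<in> K. real m * d - M \<le> Re (cnj c * z)}"
      have "?D = jspec A0 B0 \<inter> {z. inner c z \<le> (real m - 1) * d - M}" by (auto simp: Re_c)
      then show "compact ?D" by (simp add: compact_Int_closed compact_jspec closed_halfspace_le)
      show "cover K ?C ?D e" if "e > 0" for e
        using c d that by (intro cover_slab_rotated K compact_jspec ex) (auto simp: algebra_simps)
      show "continuous_on UNIV (\<lambda>z. 1 - \<rho> m z)" by (intro continuous_intros c\<rho>)
      show "0 \<le> 1 - \<rho> m z" "1 - \<rho> m z \<le> 1" for z
        using clamp01_bounds by (auto simp: \<rho>_def)
      show "z \<in> ?D" if "z \<in> jspec A0 B0" "1 - \<rho> m z \<noteq> 0" for z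
      proof -
        have "s z / d + 2 - real m < 1" using that(2) by (auto simp: \<rho>_def clamp01_def min_def max_def split: if_splits)
        then have "s z / d < real m - 1" by simp
        then have "s z < (real m - 1) * d" using d by (simp add: pos_divide_less_eq)
        then show ?thesis using that(1) by (simp add: s_def Re_c)
      qed
      show "0 \<le> \<theta> m z" "\<theta> m z \<le> 1" for z using clamp01_bounds by (auto simp: \<theta>_def)
      show "z \<in> ?C" if "z \<in> K" "\<theta> m z \<noteq> 0" for z
      proof -
        have "s z / d > real m" using that(2) by (auto simp: \<theta>_def clamp01_def min_def max_def split: if_splits)
        then have "s z > real m * d" using d by (simp add: pos_less_divide_eq)
        then show ?thesis using that(1) by (simp add: s_def Re_c)
      qed
    qed
    then have "((\<lambda>j. norm (P m j v) * (norm (Q m x) + norm x)) \<longlongrightarrow> 0 * (norm (Q m x) + norm x)) F"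
      by (intro tendsto_mult tendsto_norm_zero tendsto_const)
    then have "eventually (\<lambda>j. norm (P m j v) * (norm (Q m x) + norm x) < \<epsilon>) F"
      using \<epsilon> by (intro order_tendstoD(2)) auto
    then show ?thesis using pair
    proof eventually_elim
      case (elim j)
      then have AB: "sym_pair (A j) (B j)" by simp
      note Pj = P[OF AB, of m]
      have norm_P: "norm (P m j) \<le> 1"
        by (rule is_fun_norm_le[OF AB Pj]) (use clamp01_bounds in \<open>auto simp: \<theta>_def\<close>)
      \<comment> \<open>Splitting \<open>x = Q m x + v\<close> leaves the form at
        \<open>Q m x\<close>, bounded since \<open>norm (P m j) \<le> 1\<close>, and two terms that
        vanish with \<open>P m j v\<close>.\<close>
      have "ip (P m j x) x = ip (P m j (Q m x)) (Q m x) + ip (P m j v) (Q m x) + ip x (P m j v)"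
      proof -
        have "ip (P m j x) x = ip (P m j (Q m x)) x + ip (P m j v) x"
          using arg_cong[OF xv, of "\<lambda>u. ip (P m j u) x"]
          by (simp only: blinfun.add_right cinner_add_left plus_complex.sel)
        also have "ip (P m j (Q m x)) x = ip (P m j (Q m x)) (Q m x) + ip (P m j (Q m x)) v"
          using arg_cong[OF xv, of "\<lambda>u. ip (P m j (Q m x)) u"]
          by (simp only: cinner_add_right plus_complex.sel)
        also have "ip (P m j (Q m x)) (Q m x) + ip (P m j (Q m x)) v + ip (P m j v) x
          = ip (P m j (Q m x)) (Q m x) + ip (Q m x) (P m j v) + ip x (P m j v)"
          using is_fun_ip[OF Pj, of "Q m x" v] Re_cinner_commute[of "P m j v" x] by simp
        finally show ?thesis using Re_cinner_commute[of "P m j v" "Q m x"] by simp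
      qed
      also have "\<dots> \<le> (norm (Q m x))\<^sup>2 + norm (P m j v) * norm (Q m x) + norm x * norm (P m j v)"
      proof (intro add_mono)
        have "ip (P m j (Q m x)) (Q m x) \<le> norm (P m j (Q m x)) * norm (Q m x)" by (rule Re_cinner_le)
        also have "\<dots> \<le> (1 * norm (Q m x)) * norm (Q m x)"
          using norm_blinfun[of "P m j" "Q m x"] mult_right_mono[OF norm_P norm_ge_zero[of "Q m x"]]
          by (intro mult_right_mono) auto
        finally show "ip (P m j (Q m x)) (Q m x) \<le> (norm (Q m x))\<^sup>2" by (simp add: power2_eq_square)
      qed (rule Re_cinner_le)+
      also have "(norm (Q m x))\<^sup>2 \<le> ip (Q m x) x"
      proof -
        have "\<rho> m z * \<rho> m z \<le> \<rho> m z" for z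
          using clamp01_bounds by (simp add: \<rho>_def mult_left_le)
        then show ?thesis
          unfolding is_fun_norm_sq[OF Q] by (rule is_fun_mono[OF pair0 is_fun_mult[OF pair0 Q Q] Q])
      qed
      finally show ?case using elim(1) by (simp add: algebra_simps)
    qed
  qed
  \<comment> \<open>The interpolation weights rescaled to step \<open>d\<close>, so that weighted
    thresholds interpolate the square of \<open>s\<close>.\<close>
  define W where "W m = d\<^sup>2 * (2 * real m + 1)" for m
  have W: "W m \<ge> 0" for m by (simp add: W_def)
  define \<epsilon> where "\<epsilon> = \<delta> / (2 * ((\<Sum>m<N. W m) + 1))"
  have sumW: "(\<Sum>m<N. W m) \<ge> 0" using W by (intro sum_nonneg) auto
  then have \<epsilon>: "\<epsilon> > 0" "(\<Sum>m<N. W m) * \<epsilon> \<le> \<delta> / 2"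
    using \<delta> by (auto simp: \<epsilon>_def field_simps)
  have limit_le: "(\<Sum>m<N. W m * ip (Q m x) x) \<le> (norm (S0 x))\<^sup>2 + \<delta> / 2"
  proof -
    have "(\<Sum>m<N. W m * ip (Q m x) x) = ip ((\<Sum>m<N. W m *\<^sub>R Q m) x) x"
    proof -
      have "(\<Sum>m<N. W m * ip (Q m x) x) = (\<Sum>m<N. ip ((W m *\<^sub>R Q m) x) x)"
        by (simp add: blinfun.scaleR_left ip_simps)
      also have "\<dots> = ip (\<Sum>m<N. (W m *\<^sub>R Q m) x) x"
        by (rule bounded_bilinear.sum_left[OF bounded_bilinear_ip, symmetric])
      finally show ?thesis by (simp add: blinfun.sum_left)
    qed
    \<comment> \<open>This is the form of \<open>(s z + 3 * d)\<^sup>2\<close>: \<open>2 * d\<close>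
      for the lowered thresholds and \<open>d\<close> for the interpolation.\<close>
    also have "\<dots> \<le> ip (((S0 o\<^sub>L S0) + ((6 * d) *\<^sub>R S0 + (9 * d\<^sup>2) *\<^sub>R id_blinfun)) x) x"
    proof (rule is_fun_mono[OF pair0])
      show "is_fun A0 B0 (\<lambda>z. \<Sum>m<N. W m * \<rho> m z) (\<Sum>m<N. W m *\<^sub>R Q m)"
        by (intro is_fun_sum is_fun_cmult pair0 Q)
      show "is_fun A0 B0 (\<lambda>z. s z * s z + (6 * d * s z + 9 * d\<^sup>2))
          ((S0 o\<^sub>L S0) + ((6 * d) *\<^sub>R S0 + (9 * d\<^sup>2) *\<^sub>R id_blinfun))"
        by (rule is_fun_add[OF is_fun_mult[OF pair0 S0 S0]
            is_fun_add[OF is_fun_cmult[OF pair0 S0, of "6 * d"] is_fun_const[of A0 B0 "9 * d\<^sup>2"]]])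
      fix z assume z: "z \<in> jspec A0 B0"
      have "0 \<le> s z / d + 2" using sK(1)[of z] z XK d by (auto intro!: add_nonneg_nonneg divide_nonneg_pos)
      then have "(\<Sum>m<N. (2 * real m + 1) * \<rho> m z) \<le> (s z / d + 2 + 1)\<^sup>2"
        unfolding \<rho>_def by (rule sum_clamp01_le_square)
      then have "d\<^sup>2 * (\<Sum>m<N. (2 * real m + 1) * \<rho> m z) \<le> d\<^sup>2 * (s z / d + 2 + 1)\<^sup>2"
        by (rule mult_left_mono) simp
      also have "\<dots> = (d * (s z / d + 3))\<^sup>2" by (simp add: power_mult_distrib add.commute)
      also have "d * (s z / d + 3) = s z + 3 * d" using d by (simp add: distrib_left)
      also have "(s z + 3 * d)\<^sup>2 = s z * s z + (6 * d * s z + 9 * d\<^sup>2)" by (simp add: power2_eq_square algebra_simps)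
      finally show "(\<Sum>m<N. W m * \<rho> m z) \<le> s z * s z + (6 * d * s z + 9 * d\<^sup>2)"
        by (simp add: W_def sum_distrib_left mult.assoc)
    qed
    also have "\<dots> = (norm (S0 x))\<^sup>2 + (6 * d * ip (S0 x) x + 9 * d\<^sup>2 * (norm x)\<^sup>2)"
      using is_fun_ip[OF S0] by (simp add: blinfun.bilinear_simps ip_simps cinner_self)
    also have "6 * d * ip (S0 x) x + 9 * d\<^sup>2 * (norm x)\<^sup>2 \<le> d * a"
    proof -
      have "d * d \<le> d" using d by (simp add: mult_left_le)
      then have "9 * d\<^sup>2 * (norm x)\<^sup>2 \<le> 9 * d * (norm x)\<^sup>2"
        by (intro mult_right_mono) (auto simp: power2_eq_square)
      moreover have "d * ip (S0 x) x \<le> d * \<bar>ip (S0 x) x\<bar>" using d by (intro mult_left_mono) auto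
      moreover have "d * a = 6 * (d * \<bar>ip (S0 x) x\<bar>) + 9 * d * (norm x)\<^sup>2 + d"
        by (simp add: a_def algebra_simps)
      moreover have "6 * d * ip (S0 x) x = 6 * (d * ip (S0 x) x)" by simp
      ultimately show ?thesis using d(1) by linarith
    qed
    finally show ?thesis using d by linarith
  qed
  have "eventually (\<lambda>j. \<forall>m<N. ip (P m j x) x \<le> ip (Q m x) x + \<epsilon>) F"
  proof -
    have "eventually (\<lambda>j. \<forall>m\<in>{..<N}. ip (P m j x) x \<le> ip (Q m x) x + \<epsilon>) F"
      by (intro eventually_ball_finite ballI threshold \<epsilon>) simp
    then show ?thesis by eventually_elim auto
  qed
  then have "eventually (\<lambda>j. (norm (S j x))\<^sup>2 \<le> (norm (S0 x))\<^sup>2 + \<delta>) F"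
    using pair
  proof eventually_elim
    case (elim j)
    then have AB: "sym_pair (A j) (B j)" and sub: "jspec (A j) (B j) \<subseteq> K" by auto
    have Sj: "is_fun (A j) (B j) s (S j)" unfolding S_def s_def by (rule is_fun_affine[OF AB])
    have "(norm (S j x))\<^sup>2 \<le> ip ((\<Sum>m<N. W m *\<^sub>R P m j) x) x"
      unfolding is_fun_norm_sq[OF Sj]
    proof (rule is_fun_mono[OF AB is_fun_mult[OF AB Sj Sj]])
      show "is_fun (A j) (B j) (\<lambda>z. \<Sum>m<N. W m * \<theta> m z) (\<Sum>m<N. W m *\<^sub>R P m j)"
        by (intro is_fun_sum is_fun_cmult AB P)
      fix z assume "z \<in> jspec (A j) (B j)"
      then have z: "z \<in> K" using sub by blast
      have "0 \<le> s z / d" using sK(1)[OF z] d by simp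
      moreover have "s z / d \<le> real N"
        using divide_right_mono[OF sK(2)[OF z], of d] d N by simp
      ultimately have "(s z / d)\<^sup>2 \<le> (\<Sum>m<N. (2 * real m + 1) * \<theta> m z)"
        unfolding \<theta>_def by (rule square_le_sum_clamp01)
      then have "d\<^sup>2 * (s z / d)\<^sup>2 \<le> d\<^sup>2 * (\<Sum>m<N. (2 * real m + 1) * \<theta> m z)"
        by (rule mult_left_mono) simp
      moreover have "d\<^sup>2 * (s z / d)\<^sup>2 = s z * s z" using d by (simp add: power2_eq_square)
      ultimately show "s z * s z \<le> (\<Sum>m<N. W m * \<theta> m z)"
        by (simp add: W_def sum_distrib_left mult.assoc)
    qed
    also have "\<dots> = (\<Sum>m<N. W m * ip (P m j x) x)"
    proof -
      have "ip (\<Sum>m<N. (W m *\<^sub>R P m j) x) x = (\<Sum>m<N. ip ((W m *\<^sub>R P m j) x) x)"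
        by (rule bounded_bilinear.sum_left[OF bounded_bilinear_ip])
      then show ?thesis by (simp add: blinfun.sum_left blinfun.scaleR_left ip_simps)
    qed
    also have "\<dots> \<le> (\<Sum>m<N. W m * (ip (Q m x) x + \<epsilon>))"
      using elim(1) W by (intro sum_mono mult_left_mono) auto
    also have "\<dots> = (\<Sum>m<N. W m * ip (Q m x) x) + (\<Sum>m<N. W m) * \<epsilon>"
      by (simp add: distrib_left sum.distrib sum_distrib_right)
    finally show ?case using limit_le \<epsilon> by linarith
  qed
  then show ?thesis unfolding S_def S0_def .
qed

text \<open>Expanding the squared norm of \<open>S j x - S0 x\<close>, the upper bound for the norms
  and the weak limit of the mixed term leave at most \<open>3 * \<delta>\<close>.\<close>

lemma affine_strongly_convergent:
  assumes K: "compact K" "convex K" and ex: "jspec A0 B0 \<subseteq> {z. z extreme_point_of K}"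
    and c: "c \<noteq> 0"
  shows "((\<lambda>j. (Re c *\<^sub>R A j + Im c *\<^sub>R B j) x) \<longlongrightarrow> (Re c *\<^sub>R A0 + Im c *\<^sub>R B0) x) F"
proof (rule tendstoI)
  fix e :: real assume e: "e > 0"
  obtain R where R: "\<And>z. z \<in> K \<Longrightarrow> norm z \<le> R" using compact_imp_bounded[OF K(1)] bounded_iff by metis
  \<comment> \<open>Adding \<open>M\<close> makes the affine function nonnegative on
    \<open>K\<close>, where squaring is monotone; it cancels in the difference.\<close>
  define M where "M = norm c * R"
  have M: "\<bar>inner c z\<bar> \<le> M" if "z \<in> K" for z
  proof -
    have "\<bar>inner c z\<bar> \<le> norm c * norm z" by (rule Cauchy_Schwarz_ineq2)
    also have "\<dots> \<le> M" unfolding M_def using R[OF that] by (intro mult_left_mono) auto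
    finally show ?thesis .
  qed
  define S where "S j = Re c *\<^sub>R A j + Im c *\<^sub>R B j + M *\<^sub>R id_blinfun" for j
  define S0 where "S0 = Re c *\<^sub>R A0 + Im c *\<^sub>R B0 + M *\<^sub>R id_blinfun"
  define \<delta> where "\<delta> = e\<^sup>2 / 4"
  have \<delta>: "\<delta> > 0" using e by (simp add: \<delta>_def)
  have "eventually (\<lambda>j. ip (S j x) (S0 x) > ip (S0 x) (S0 x) - \<delta>) F"
    unfolding S_def S0_def using \<delta> by (intro order_tendstoD(1)[OF limit_affine]) simp
  moreover have "eventually (\<lambda>j. (norm (S j x))\<^sup>2 \<le> (norm (S0 x))\<^sup>2 + \<delta>) F"
    unfolding S_def S0_def using K ex c M \<delta> by (rule eventually_square_le)
  ultimately show "eventually (\<lambda>j. dist ((Re c *\<^sub>R A j + Im c *\<^sub>R B j) x) ((Re c *\<^sub>R A0 + Im c *\<^sub>R B0) x) < e) F"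
  proof eventually_elim
    case (elim j)
    have "(norm (S j x - S0 x))\<^sup>2 \<le> 3 * \<delta>"
      using elim by (simp add: norm_diff_squared cinner_self)
    also have "\<dots> < e\<^sup>2" using e by (simp add: \<delta>_def)
    finally have "norm (S j x - S0 x) < e" using e by (intro power2_less_imp_less[of _ e]) auto
    moreover have "S j x - S0 x = (Re c *\<^sub>R A j + Im c *\<^sub>R B j) x - (Re c *\<^sub>R A0 + Im c *\<^sub>R B0) x"
      by (simp add: S_def S0_def blinfun.bilinear_simps)
    ultimately show ?case by (simp add: dist_norm)
  qed
qed

end

section \<open>Real and imaginary parts of a normal operator\<close>

definition re_op :: "('a :: complex_hilbert_space \<Rightarrow>\<^sub>L 'a) \<Rightarrow> 'a \<Rightarrow>\<^sub>L 'a" where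
  "re_op T = (1 / 2) *\<^sub>R (T + cadjoint T)"

definition im_op :: "('a :: complex_hilbert_space \<Rightarrow>\<^sub>L 'a) \<Rightarrow> 'a \<Rightarrow>\<^sub>L 'a" where
  "im_op T = scalar_op (- \<i> / 2) o\<^sub>L (T - cadjoint T)"

lemma re_op_apply: "re_op T x = (1 / 2) *\<^sub>R (T x + cadjoint T x)"
  by (simp add: re_op_def blinfun.bilinear_simps)

lemma im_op_apply: "im_op T x = (- \<i> / 2) *\<^sub>C (T x - cadjoint T x)"
  by (simp add: im_op_def blinfun.diff_left scalar_op.rep_eq)

lemma scaleC_diff_right: "a *\<^sub>C (x - y) = a *\<^sub>C x - a *\<^sub>C (y :: 'a :: complex_inner)"
  using scaleC_add_right[of a "x - y" y] by simp

lemma cinner_cadjoint_left: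
  assumes "T \<in> bounded_clinear_ops"
  shows "cinner (cadjoint T x) y = cnj (cinner (T y) x)"
  by (metis assms cinner_cadjoint cinner_commute)

text \<open>Exchanging the arguments removes the adjoint from the form, so weak convergence passes
  from \<open>T\<close> to its parts.\<close>

lemma ip_re_op:
  assumes T: "T \<in> bounded_clinear_ops"
  shows "ip (re_op T x) y = (Re (cinner (T x) y) + Re (cinner (T y) x)) / 2"
  by (simp add: re_op_apply ip_simps cinner_cadjoint_left[OF T] add_divide_distrib)

lemma ip_im_op:
  assumes T: "T \<in> bounded_clinear_ops"
  shows "ip (im_op T x) y = (Im (cinner (T x) y) + Im (cinner (T y) x)) / 2"
  by (simp add: im_op_apply cinner_scaleC_left cinner_diff_left cinner_cadjoint_left[OF T] field_simps)

lemma sym_pair_re_im: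
  assumes T: "T \<in> bounded_clinear_ops" and normal: "normal_op T"
  shows "sym_pair (re_op T) (im_op T)"
proof -
  have TT: "cadjoint T (T x) = T (cadjoint T x)" for x
    using normal unfolding normal_op_def by (metis blinfun_apply_blinfun_compose)
  have lin: "S (c *\<^sub>C x) = c *\<^sub>C S x" if "S \<in> bounded_clinear_ops" for S :: "'a \<Rightarrow>\<^sub>L 'a" and c x
    using that by (simp add: bounded_clinear_ops_def)
  have "sym_op (re_op T)"
    unfolding sym_op_def by (metis ip_re_op[OF T] Re_cinner_commute add.commute)
  moreover have "sym_op (im_op T)"
    unfolding sym_op_def by (metis ip_im_op[OF T] Re_cinner_commute add.commute)
  moreover have "commute (re_op T) (im_op T)"
    unfolding commute_def
    by (simp add: re_op_apply im_op_apply lin[OF T] lin[OF cadjoint_in_bounded_clinear_ops[OF T]] TT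
        blinfun.bilinear_simps scaleC_add_right[symmetric] scaleC_diff_right[symmetric] scaleC_scaleC scaleC_of_real[symmetric] mult.commute)
  ultimately show ?thesis by (simp add: sym_pair_def)
qed

lemma re_im_decomposition:
  fixes T :: "'a :: complex_hilbert_space \<Rightarrow>\<^sub>L 'a"
  shows "T x = re_op T x + \<i> *\<^sub>C im_op T x"
proof -
  have "\<i> *\<^sub>C im_op T x = (1 / 2) *\<^sub>R (T x - cadjoint T x)"
    by (simp add: im_op_apply scaleC_scaleC scaleC_of_real[symmetric])
  then show ?thesis by (simp add: re_op_apply scaleR_add_right[symmetric] scaleR_2[symmetric])
qed

text \<open>On joint approximate eigenvectors \<open>T - l\<close> is arbitrarily small, which a
  bounded left inverse \<open>S\<close> forbids; \<open>e\<close> is chosen with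
  \<open>2 * e * norm S < 1\<close>.\<close>

lemma jspec_subset_spectrum:
  fixes T :: "'a :: complex_hilbert_space \<Rightarrow>\<^sub>L 'a"
  shows "jspec (re_op T) (im_op T) \<subseteq> spectrum T"
proof (rule subsetI, rule ccontr)
  fix l assume l: "l \<in> jspec (re_op T) (im_op T)" and "l \<notin> spectrum T"
  then obtain S where S: "S o\<^sub>L (T - scalar_op l) = id_blinfun" unfolding spectrum_def by blast
  define e where "e = 1 / (2 * (norm S + 1))"
  have nS: "norm S + 1 > 0" by (simp add: add_nonneg_pos)
  have e: "e > 0" using nS by (simp add: e_def)
  obtain x where x: "norm x = 1" "norm (re_op T x - Re l *\<^sub>R x) < e" "norm (im_op T x - Im l *\<^sub>R x) < e"
    using l e unfolding jspec_def by blast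
  have "l *\<^sub>C x = Re l *\<^sub>R x + \<i> *\<^sub>C (Im l *\<^sub>R x)"
    by (simp add: scaleC_of_real[symmetric] scaleC_scaleC scaleC_add_left[symmetric] complex_eq[symmetric])
  then have eq: "(T - scalar_op l) x = (re_op T x - Re l *\<^sub>R x) + \<i> *\<^sub>C (im_op T x - Im l *\<^sub>R x)"
    using re_im_decomposition[of T x] by (simp add: blinfun.diff_left scalar_op.rep_eq scaleC_diff_right)
  have less: "norm ((T - scalar_op l) x) < 2 * e"
    unfolding eq using x norm_triangle_ineq[of "re_op T x - Re l *\<^sub>R x" "\<i> *\<^sub>C (im_op T x - Im l *\<^sub>R x)"]
    by (simp add: norm_scaleC)
  have "1 \<le> norm S * norm ((T - scalar_op l) x)"
  proof -
    have "S ((T - scalar_op l) x) = x" using S by (metis blinfun_apply_blinfun_compose id_blinfun.rep_eq)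
    then show ?thesis using norm_blinfun[of S "(T - scalar_op l) x"] x by simp
  qed
  also have "\<dots> \<le> norm S * (2 * e)" using less by (intro mult_left_mono) auto
  also have "\<dots> < 1" using nS by (simp add: e_def field_simps)
  finally show False by simp
qed

text \<open>Only the limit has its spectrum in the extreme points; for the approximating operators
  the spectrum may be anywhere in \<open>K\<close>.\<close>

lemma weak_strong_convergence:
  fixes T0 :: "'a :: complex_hilbert_space \<Rightarrow>\<^sub>L 'a" and F :: "('a \<Rightarrow>\<^sub>L 'a) filter"
  assumes K: "compact K" "convex K"
    and F: "eventually (\<lambda>T. T \<in> bounded_clinear_ops \<and> normal_op T \<and> spectrum T \<subseteq> K) F"
    and T0: "T0 \<in> bounded_clinear_ops" "normal_op T0" "spectrum T0 \<subseteq> {z. z extreme_point_of K}"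
    and weak: "\<And>x y. ((\<lambda>T. cinner (blinfun_apply T x) y) \<longlongrightarrow> cinner (T0 x) y) F"
  shows "((\<lambda>T. blinfun_apply T x) \<longlongrightarrow> T0 x) F"
proof -
  interpret weakly_convergent_pairs F re_op im_op "re_op T0" "im_op T0" K
  proof
    show "eventually (\<lambda>T. sym_pair (re_op T) (im_op T) \<and> jspec (re_op T) (im_op T) \<subseteq> K) F"
      using F by eventually_elim (use sym_pair_re_im jspec_subset_spectrum in blast)
    show "sym_pair (re_op T0) (im_op T0)" using T0 by (intro sym_pair_re_im)
    fix x y
    have "((\<lambda>T. (Re (cinner (blinfun_apply T x) y) + Re (cinner (blinfun_apply T y) x)) / 2) \<longlongrightarrow> ip (re_op T0 x) y) F"
      unfolding ip_re_op[OF T0(1)] by (intro tendsto_intros weak) simp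
    then show "((\<lambda>T. ip (re_op T x) y) \<longlongrightarrow> ip (re_op T0 x) y) F"
      by (rule Lim_transform_eventually) (use F in eventually_elim, simp add: ip_re_op)
    have "((\<lambda>T. (Im (cinner (blinfun_apply T x) y) + Im (cinner (blinfun_apply T y) x)) / 2) \<longlongrightarrow> ip (im_op T0 x) y) F"
      unfolding ip_im_op[OF T0(1)] by (intro tendsto_intros weak) simp
    then show "((\<lambda>T. ip (im_op T x) y) \<longlongrightarrow> ip (im_op T0 x) y) F"
      by (rule Lim_transform_eventually) (use F in eventually_elim, simp add: ip_im_op)
  qed
  have ex: "jspec (re_op T0) (im_op T0) \<subseteq> {z. z extreme_point_of K}"
    using jspec_subset_spectrum T0(3) by blast
  \<comment> \<open>The directions 1 and \<open>\<i>\<close> select the real and the imaginary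
    part.\<close>
  have "((\<lambda>T. re_op T x) \<longlongrightarrow> re_op T0 x) F"
    using affine_strongly_convergent[OF K ex, of 1 x] by simp
  moreover have "((\<lambda>T. im_op T x) \<longlongrightarrow> im_op T0 x) F"
    using affine_strongly_convergent[OF K ex, of \<i> x] by simp
  then have "((\<lambda>T. scalar_op \<i> (im_op T x)) \<longlongrightarrow> scalar_op \<i> (im_op T0 x)) F"
    by (rule blinfun.tendsto[OF tendsto_const])
  ultimately have "((\<lambda>T. re_op T x + scalar_op \<i> (im_op T x)) \<longlongrightarrow> re_op T0 x + scalar_op \<i> (im_op T0 x)) F"
    by (rule tendsto_add)
  then show ?thesis by (simp add: scalar_op.rep_eq re_im_decomposition[symmetric])
qed

section \<open>Comparison of the operator topologies\<close>

text \<open>The universal property of an initial topology.\<close>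

lemma continuous_map_weak_operator_topology:
  fixes f :: "'b \<Rightarrow> 'a :: complex_inner \<Rightarrow>\<^sub>L 'a"
  shows "continuous_map X weak_operator_topology f \<longleftrightarrow>
    (\<forall>x y. continuous_map X euclidean (\<lambda>p. cinner (f p x) y))"
proof
  assume f: "continuous_map X weak_operator_topology f"
  show "\<forall>x y. continuous_map X euclidean (\<lambda>p. cinner (f p x) y)"
  proof (intro allI)
    fix x y
    have "continuous_map euclidean euclidean (\<lambda>g :: 'a \<times> 'a \<Rightarrow> complex. g (x, y))" by simp
    then have "continuous_map weak_operator_topology euclidean
        ((\<lambda>g. g (x, y)) \<circ> (\<lambda>T :: 'a \<Rightarrow>\<^sub>L 'a. \<lambda>(x, y). cinner (T x) y))"
      unfolding weak_operator_topology_def by (rule continuous_map_pullback)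
    then show "continuous_map X euclidean (\<lambda>p. cinner (f p x) y)"
      using continuous_map_compose[OF f] by (simp add: o_def)
  qed
next
  assume f: "\<forall>x y. continuous_map X euclidean (\<lambda>p. cinner (f p x) y)"
  have "continuous_map X (product_topology (\<lambda>_. euclidean) UNIV)
      ((\<lambda>T :: 'a \<Rightarrow>\<^sub>L 'a. \<lambda>(x, y). cinner (T x) y) \<circ> f)"
    unfolding continuous_map_componentwise_UNIV using f by (simp add: o_def split_beta)
  then show "continuous_map X weak_operator_topology f"
    unfolding weak_operator_topology_def
    by (intro continuous_map_pullback') (simp_all add: euclidean_product_topology)
qed

lemma topspace_weak_operator_topology: "topspace weak_operator_topology = UNIV"
  by (simp add: weak_operator_topology_def topspace_pullback_topology)

lemma topology_eqI_continuous_map: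
  assumes "topspace X = topspace Y" "continuous_map X Y (\<lambda>x. x)" "continuous_map Y X (\<lambda>x. x)"
  shows "X = Y"
proof -
  have "openin X U \<longleftrightarrow> openin Y U" for U
  proof
    assume U: "openin X U"
    have "{x \<in> topspace Y. x \<in> U} = U" using openin_subset[OF U] assms(1) by auto
    then show "openin Y U" using openin_continuous_map_preimage[OF assms(3) U] by simp
  next
    assume U: "openin Y U"
    have "{x \<in> topspace X. x \<in> U} = U" using openin_subset[OF U] assms(1) by auto
    then show "openin X U" using openin_continuous_map_preimage[OF assms(2) U] by simp
  qed
  then show ?thesis by (simp add: topology_eq)
qed

theorem corollary3p9:
  fixes K :: "complex set"
    and A :: "('a :: complex_hilbert_space \<Rightarrow>\<^sub>L 'a) set"
  assumes "compact K" and "convex K"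
  defines "A \<equiv> {T \<in> bounded_clinear_ops. normal_op T \<and> spectrum T \<subseteq> {z. z extreme_point_of K}}"
  shows "subtopology weak_operator_topology A = subtopology strong_operator_topology A"
proof (rule topology_eqI_continuous_map)
  let ?W = "subtopology weak_operator_topology A :: ('a \<Rightarrow>\<^sub>L 'a) topology"
  let ?S = "subtopology strong_operator_topology A :: ('a \<Rightarrow>\<^sub>L 'a) topology"
  have topW: "topspace ?W = A" by (simp add: topspace_weak_operator_topology)
  have topS: "topspace ?S = A" by (simp add: strong_operator_topology_topspace)
  show "topspace ?W = topspace ?S" using topW topS by simp
  \<comment> \<open>Evaluation followed by a bounded functional is strongly continuous; this
    direction does not depend on the choice of \<open>A\<close>.\<close>
  have "continuous_map ?S weak_operator_topology (\<lambda>T. T)"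
    unfolding continuous_map_weak_operator_topology
  proof (intro allI)
    fix x y :: 'a
    have "continuous_map ?S euclidean (\<lambda>T. blinfun_apply T x)"
      by (intro continuous_map_from_subtopology strong_operator_topology_continuous_evaluation)
    moreover have "continuous_on UNIV (\<lambda>v. cinner v y)"
    proof -
      have "bounded_linear (\<lambda>v. cinner v y)"
      proof (rule bounded_linear_intro)
        show "norm (cinner v y) \<le> norm v * (2 * norm y)" for v
        proof -
          have "\<bar>Im (cinner v y)\<bar> = \<bar>ip (\<i> *\<^sub>C v) y\<bar>" by (simp add: cinner_scaleC_left)
          also have "\<dots> \<le> norm v * norm y" using abs_ip_le[of "\<i> *\<^sub>C v" y] by (simp add: norm_scaleC)
          finally show ?thesis using abs_ip_le[of v y] cmod_le[of "cinner v y"] by simp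
        qed
      qed (simp_all add: cinner_add_left cinner_scaleR_left scaleR_conv_of_real)
      then show ?thesis by (intro linear_continuous_on)
    qed
    then have "continuous_map euclidean euclidean (\<lambda>v. cinner v y)" by simp
    ultimately show "continuous_map ?S euclidean (\<lambda>T. cinner (blinfun_apply T x) y)"
      using continuous_map_compose[of ?S euclidean "\<lambda>T. blinfun_apply T x" euclidean "\<lambda>v. cinner v y"] by (simp add: o_def)
  qed
  then show "continuous_map ?S ?W (\<lambda>T. T)"
    using topS by (simp add: continuous_map_in_subtopology)
  have "continuous_map ?W strong_operator_topology (\<lambda>T. T)"
    unfolding continuous_on_strong_operator_topo_iff_coordinatewise
  proof (intro allI)
    fix x :: 'a
    \<comment> \<open>Continuity is tested at each \<open>T0\<close> along its neighbourhood filter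
      within \<open>A\<close>, to which \<open>weak_strong_convergence\<close> applies.\<close>
    show "continuous_map ?W euclidean (\<lambda>T. blinfun_apply T x)"
      unfolding continuous_map_atin limitin_canonical_iff
    proof
      fix T0 assume "T0 \<in> topspace ?W"
      then have T0: "T0 \<in> A" using topW by simp
      have ev: "eventually (\<lambda>T. T \<in> A) (atin ?W T0)"
        unfolding eventually_atin using topW T0 openin_topspace[of ?W] by (intro disjI2 exI[of _ A]) auto
      have "continuous_map ?W weak_operator_topology (\<lambda>T. T)"
        by (intro continuous_map_from_subtopology) simp
      have weak: "((\<lambda>T. cinner (blinfun_apply T u) v) \<longlongrightarrow> cinner (T0 u) v) (atin ?W T0)" for u v
      proof -
        have "continuous_map ?W euclidean (\<lambda>T. cinner (blinfun_apply T u) v)"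
          using \<open>continuous_map ?W weak_operator_topology (\<lambda>T. T)\<close>
          unfolding continuous_map_weak_operator_topology by blast
        then show ?thesis using T0 topW unfolding continuous_map_atin limitin_canonical_iff by blast
      qed
      show "((\<lambda>T. blinfun_apply T x) \<longlongrightarrow> T0 x) (atin ?W T0)"
      proof (rule weak_strong_convergence[OF assms(1,2)])
        show "eventually (\<lambda>T. T \<in> bounded_clinear_ops \<and> normal_op T \<and> spectrum T \<subseteq> K) (atin ?W T0)"
          using ev by eventually_elim (auto simp: A_def extreme_point_of_def)
      qed (use T0 weak in \<open>auto simp: A_def\<close>)
    qed
  qed
  then show "continuous_map ?W ?S (\<lambda>T. T)"
    using topW by (simp add: continuous_map_in_subtopology)
qed

end
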